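(* Let $\mathcal{A}\mathsf{gd}^!$ be the Koszul dual operad of the AsGDer operad $\mathcal{A}\mathsf{gd}$. Then for all $n\ge 1$ $$\mathcal{A}\mathsf{gd}^!(n)=\Bbbk\bar\mu_n\oplus\Bbbk\bar h_n\oplus\Bbbk\bar\delta_n$$ with $|\bar\mu_n|=0$ and $|\bar h_n|=|\bar\delta_n|=-1$; the element $\bar\mu_1\in\mathcal{A}\mathsf{gd}^!(1)$ is the identity; and the partial compositions (for $n,m\ge 1$, $1\le i\le n$) are given by $$\bar\mu_n\circ_i\bar\mu_m=\bar\mu_{m+n-1},\qquad \bar h_n\circ_i\bar\mu_m=\bar h_{m+n-1},\qquad \bar\delta_n\circ_i\bar\mu_m=\bar\delta_{m+n-1},$$ $$\bar\mu_n\circ_i\bar h_m=\begin{cases}\bar h_{m+n-1}, & i=1,\\ \bar\delta_{m+n-1}+\bar h_{m+n-1}, & 2\le i\le n,\end{cases}\qquad \bar\mu_n\circ_i\bar\delta_m=\begin{cases}\bar\delta_{m+n-1}, & i=1,\\ 0, & 2\le i\le n,\end{cases}$$ $$\bar h_n\circ_i\bar h_m=0,\qquad \bar\delta_n\circ_i\bar h_m=0,\qquad \bar h_n\circ_i\bar\delta_m=0,\qquad \bar\delta_n\circ_i\bar\delta_m=0.$$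
   Context: $\Bbbk$ is a field of characteristic zero. All (co)operads are $\Bbbk$-linear, nonsymmetric (ns), graded, and reduced (zero in arity $0$). Koszul sign conventions are used; descriptions of (co)operads are up to isomorphism. The AsGDer operad $\mathcal{A}\mathsf{gd}=\mathcal{F}(E)/(R)$ is the ns quadratic operad with generators $E(1)=\Bbbk h\oplus\Bbbk\delta$, $E(2)=\Bbbk\mu$, $E(n)=0$ for $n\ne 1,2$ (all in degree $0$), where $\mathcal{F}(E)$ is the free ns operad on $E$ and $(R)$ is the operadic ideal generated by the space $R\subset \mathcal{F}(E)^{(2)}$ (weight $2$ part) spanned by $$\mu\circ_1\mu-\mu\circ_2\mu,\qquad h\circ_1\mu-\mu\circ_1h-\mu\circ_2h,\qquad \delta\circ_1\mu-\mu\circ_1\delta-\mu\circ_2h.$$ For a quadratic ns operad $\mathcal{P}=\mathcal{F}(E)/(R)$, the Koszul dual cooperad is $\mathcal{P}^{¡}=\mathcal{C}(sE,s^2R)$, where $s$ raises degree by $1$ and $\mathcal{C}(sE,s^2R)$ is the quadratic cooperad, i.e. the universal sub-cooperad $\mathcal{C}$ of the cofree conilpotent cooperad $\mathcal{F}^c(sE)$ such that the composite $\mathcal{C}\hookrightarrow\mathcal{F}^c(sE)\twoheadrightarrow\mathcal{F}^c(sE)^{(2)}/s^2R$ is zero. The Koszul dual operad is $\mathcal{P}^!=(\mathcal{S}^c\otimes_{\mathrm H}\mathcal{P}^{¡})^*$, where $\otimes_{\mathrm H}$ is the arity-wise (Hadamard) tensor product, $(-)^*$ is the arity-wise linear dual,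 and $\mathcal{S}^c$ is the ns cooperad with $\mathcal{S}^c(n)=\Bbbk\beta_n$, $|\beta_n|=1-n$, and infinitesimal decomposition $\Delta_{(1)}(\beta_n)=\sum_{p+q+r=n}(-1)^{p(q-1)}\beta_{p+r+1}\boxtimes_{p+1}\beta_q$ (sum over $p,r\ge 0$, $q\ge 1$), where $\alpha\boxtimes_i\beta$ denotes $\alpha\otimes(\mathbf 1^{\otimes i-1}\otimes\beta\otimes\mathbf 1^{\otimes k-i})$ for $\alpha$ of arity $k$. *)

theory Defs
  imports Complex_Main "HOL-Library.Poly_Mapping" "HOL-Library.Function_Algebras"
begin

text \<open>
  Throughout, a graded ns collection is encoded inside a free vector space \<open>'b \<Rightarrow>\<^sub>0 'k\<close> whose
  basis elements are homogeneous, i.e. have an arity and a degree.  Over a field this is no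
  restriction, and it makes tensor products concrete: \<open>k[A] \<otimes> k[B] = k[A \<times> B]\<close>, and the tensor
  product of two subspaces is the span of the pure tensors.  Degrees are homological.
\<close>

section \<open>Free vector spaces\<close>

abbreviation keys :: "('b \<Rightarrow>\<^sub>0 'k::zero) \<Rightarrow> 'b set" where "keys \<equiv> Poly_Mapping.keys"
abbreviation lookup :: "('b \<Rightarrow>\<^sub>0 'k::zero) \<Rightarrow> 'b \<Rightarrow> 'k" where "lookup \<equiv> Poly_Mapping.lookup"

definition smul :: "'k::field \<Rightarrow> ('b \<Rightarrow>\<^sub>0 'k) \<Rightarrow> ('b \<Rightarrow>\<^sub>0 'k)" where
  "smul c x = Poly_Mapping.map ((*) c) x"

lemma lookup_smul: "lookup (smul c x) b = c * lookup x b"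
  by (simp add: smul_def Poly_Mapping.map.rep_eq in_keys_iff when_def)

global_interpretation pm: vector_space "smul :: 'k::field \<Rightarrow> ('b \<Rightarrow>\<^sub>0 'k) \<Rightarrow> _"
  by standard (simp_all add: poly_mapping_eq_iff fun_eq_iff lookup_smul lookup_add algebra_simps)

definition lin_extend :: "('b \<Rightarrow> ('c \<Rightarrow>\<^sub>0 'k::field)) \<Rightarrow> ('b \<Rightarrow>\<^sub>0 'k) \<Rightarrow> ('c \<Rightarrow>\<^sub>0 'k)" where
  "lin_extend F x = (\<Sum>b\<in>keys x. smul (lookup x b) (F b))"

definition ksign :: "int \<Rightarrow> 'k::field" where
  "ksign d = (if even d then 1 else - 1)"


section \<open>Graded ns operads and cooperads\<close>

text \<open>
  \<open>op_part P n d\<close> is the homogeneous component of arity \<open>n\<close> and degree \<open>d\<close>, and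
  \<open>pcomp P n i m x y\<close> is the partial composition \<open>x \<circ>\<^sub>i y\<close> of \<open>x\<close> of arity \<open>n\<close> and \<open>y\<close> of arity \<open>m\<close>.
\<close>

record ('v, 'k) ns_operad =
  op_part :: "nat \<Rightarrow> int \<Rightarrow> 'v set"
  scl :: "'k \<Rightarrow> 'v \<Rightarrow> 'v"
  pcomp :: "nat \<Rightarrow> nat \<Rightarrow> nat \<Rightarrow> 'v \<Rightarrow> 'v \<Rightarrow> 'v"
  ident :: 'v

definition op_arity :: "('v::ab_group_add, 'k::field) ns_operad \<Rightarrow> nat \<Rightarrow> 'v set" where
  "op_arity P n = module.span (scl P) (\<Union>d. op_part P n d)"

text \<open>
  \<open>barity\<close> and \<open>bdegree\<close> are the arity and degree of the basis elements of the ambient space,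
  \<open>co_part C n d\<close> is the homogeneous component of arity \<open>n\<close> and degree \<open>d\<close> (a subspace of the
  ambient space), \<open>bdec\<close> and \<open>bcounit\<close> are the infinitesimal decomposition and the counit on
  ambient basis elements.  The basis element \<open>(a, i, b)\<close> of the target of \<open>bdec\<close> is \<open>a \<boxtimes>\<^sub>i b\<close>.
\<close>

record (overloaded) ('b, 'k) ns_cooperad =
  barity :: "'b \<Rightarrow> nat"
  bdegree :: "'b \<Rightarrow> int"
  co_part :: "nat \<Rightarrow> int \<Rightarrow> ('b \<Rightarrow>\<^sub>0 'k) set"
  bdec :: "'b \<Rightarrow> ('b \<times> nat \<times> 'b \<Rightarrow>\<^sub>0 'k)"
  bcounit :: "'b \<Rightarrow> 'k"

definition co_arity :: "('b, 'k::field) ns_cooperad \<Rightarrow> nat \<Rightarrow> ('b \<Rightarrow>\<^sub>0 'k) set" where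
  "co_arity C n = pm.span (\<Union>d. co_part C n d)"

definition dec :: "('b, 'k::field) ns_cooperad \<Rightarrow> ('b \<Rightarrow>\<^sub>0 'k) \<Rightarrow> ('b \<times> nat \<times> 'b \<Rightarrow>\<^sub>0 'k)" where
  "dec C = lin_extend (bdec C)"

definition counit :: "('b, 'k::field) ns_cooperad \<Rightarrow> ('b \<Rightarrow>\<^sub>0 'k) \<Rightarrow> 'k" where
  "counit C x = (\<Sum>b\<in>keys x. lookup x b * bcounit C b)"

definition boxtensor :: "nat \<Rightarrow> ('b \<Rightarrow>\<^sub>0 'k::field) \<Rightarrow> ('b \<Rightarrow>\<^sub>0 'k) \<Rightarrow> ('b \<times> nat \<times> 'b \<Rightarrow>\<^sub>0 'k)" where
  "boxtensor i x y = (\<Sum>a\<in>keys x. \<Sum>b\<in>keys y. Poly_Mapping.single (a, i, b) (lookup x a * lookup y b))"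

text \<open>A graded sub-collection \<open>D\<close> is a sub-cooperad if \<open>\<Delta>\<^sub>(\<^sub>1\<^sub>)(D) \<subseteq> D \<circ>\<^sub>(\<^sub>1\<^sub>) D\<close>.\<close>

definition sub_cooperad :: "('b, 'k::field) ns_cooperad \<Rightarrow> (nat \<Rightarrow> int \<Rightarrow> ('b \<Rightarrow>\<^sub>0 'k) set) \<Rightarrow> bool" where
  "sub_cooperad C D \<longleftrightarrow>
     (\<forall>n d. pm.subspace (D n d) \<and> D n d \<subseteq> co_part C n d) \<and>
     (\<forall>n d. \<forall>x\<in>D n d. dec C x \<in>
        pm.span {boxtensor i y z | i k p m q y z. 1 \<le> i \<and> i \<le> k \<and> y \<in> D k p \<and> z \<in> D m q})"


section \<open>Planar trees, free operads and cofree conilpotent cooperads\<close>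

datatype 'e ptree = Leaf | Node 'e "'e ptree list"

primrec leaves :: "'e ptree \<Rightarrow> nat" where
  "leaves Leaf = 1"
| "leaves (Node e ts) = sum_list (map leaves ts)"

primrec weight :: "'e ptree \<Rightarrow> nat" where
  "weight Leaf = 0"
| "weight (Node e ts) = 1 + sum_list (map weight ts)"

primrec tdegree :: "('e \<Rightarrow> int) \<Rightarrow> 'e ptree \<Rightarrow> int" where
  "tdegree dg Leaf = 0"
| "tdegree dg (Node e ts) = dg e + sum_list (map (tdegree dg) ts)"

fun wf_tree :: "('e \<Rightarrow> nat) \<Rightarrow> 'e ptree \<Rightarrow> bool" where
  "wf_tree ar Leaf = True"
| "wf_tree ar (Node e ts) = (length ts = ar e \<and> (\<forall>t\<in>set ts. wf_tree ar t))"

definition corolla :: "('e \<Rightarrow> nat) \<Rightarrow> 'e \<Rightarrow> 'e ptree" where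
  "corolla ar e = Node e (replicate (ar e) Leaf)"

text \<open>\<open>graft t i s\<close> grafts \<open>s\<close> onto the \<open>i\<close>-th leaf of \<open>t\<close>, for \<open>1 \<le> i \<le> leaves t\<close>.\<close>

fun graft :: "'e ptree \<Rightarrow> nat \<Rightarrow> 'e ptree \<Rightarrow> 'e ptree"
  and graft_list :: "'e ptree list \<Rightarrow> nat \<Rightarrow> 'e ptree \<Rightarrow> 'e ptree list" where
  "graft Leaf i s = s"
| "graft (Node e ts) i s = Node e (graft_list ts i s)"
| "graft_list [] i s = []"
| "graft_list (t # ts) i s =
     (if i \<le> leaves t then graft t i s # ts else t # graft_list ts (i - leaves t) s)"

text \<open>
  A tree with vertices \<open>v\<^sub>1, \<dots>, v\<^sub>w\<close>, listed in planar depth-first order (a vertex before its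
  subtrees, subtrees from left to right), stands for \<open>v\<^sub>1 \<otimes> \<dots> \<otimes> v\<^sub>w\<close>.  Hence (un)grafting \<open>s\<close> at the
  \<open>i\<close>-th leaf of \<open>t\<close> moves \<open>s\<close> past those vertices of \<open>t\<close> that come after this leaf;
  \<open>degree_after dg t i\<close> is their total degree.
\<close>

fun degree_after :: "('e \<Rightarrow> int) \<Rightarrow> 'e ptree \<Rightarrow> nat \<Rightarrow> int"
  and degree_after_list :: "('e \<Rightarrow> int) \<Rightarrow> 'e ptree list \<Rightarrow> nat \<Rightarrow> int" where
  "degree_after dg Leaf i = 0"
| "degree_after dg (Node e ts) i = degree_after_list dg ts i"
| "degree_after_list dg [] i = 0"
| "degree_after_list dg (t # ts) i =
     (if i \<le> leaves t then degree_after dg t i + sum_list (map (tdegree dg) ts)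
      else degree_after_list dg ts (i - leaves t))"

definition graft_sign :: "('e \<Rightarrow> int) \<Rightarrow> 'e ptree \<Rightarrow> nat \<Rightarrow> 'e ptree \<Rightarrow> 'k::field" where
  "graft_sign dg t i s = ksign (tdegree dg s * degree_after dg t i)"

definition tree_part :: "('e \<Rightarrow> nat) \<Rightarrow> ('e \<Rightarrow> int) \<Rightarrow> nat \<Rightarrow> int \<Rightarrow> ('e ptree \<Rightarrow>\<^sub>0 'k::field) set" where
  "tree_part ar dg n d = {x. \<forall>t\<in>keys x. wf_tree ar t \<and> leaves t = n \<and> tdegree dg t = d}"

text \<open>
  The collection \<open>E\<close> of generators is given by a type \<open>'e\<close> of homogeneous basis elements with
  arities \<open>ar\<close> and degrees \<open>dg\<close>.
\<close>

definition free_operad ::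
  "('e \<Rightarrow> nat) \<Rightarrow> ('e \<Rightarrow> int) \<Rightarrow> ('e ptree \<Rightarrow>\<^sub>0 'k::field, 'k) ns_operad" where
  "free_operad ar dg =
    \<lparr> op_part = tree_part ar dg,
      scl = smul,
      pcomp = (\<lambda>n i m x y. \<Sum>t\<in>keys x. \<Sum>s\<in>keys y.
                 Poly_Mapping.single (graft t i s) (graft_sign dg t i s * lookup x t * lookup y s)),
      ident = Poly_Mapping.single Leaf 1 \<rparr>"

text \<open>The sum over all \<open>(a, i, b)\<close> below is the sum over all edges (leaves and root included) of \<open>t\<close>.\<close>

definition cofree_cooperad ::
  "('e \<Rightarrow> nat) \<Rightarrow> ('e \<Rightarrow> int) \<Rightarrow> ('e ptree, 'k::field) ns_cooperad" where
  "cofree_cooperad ar dg =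
    \<lparr> barity = leaves,
      bdegree = tdegree dg,
      co_part = tree_part ar dg,
      bdec = (\<lambda>t. \<Sum>(a, i, b)\<in>{(a, i, b). 1 \<le> i \<and> i \<le> leaves a \<and> graft a i b = t}.
                 Poly_Mapping.single (a, i, b) (graft_sign dg a i b)),
      bcounit = (\<lambda>t. if t = Leaf then 1 else 0) \<rparr>"

definition weight_part :: "nat \<Rightarrow> ('e ptree \<Rightarrow>\<^sub>0 'k::field) \<Rightarrow> ('e ptree \<Rightarrow>\<^sub>0 'k)" where
  "weight_part w x = (\<Sum>t\<in>{t\<in>keys x. weight t = w}. Poly_Mapping.single t (lookup x t))"


section \<open>Quadratic data and Koszul duals\<close>

text \<open>
  \<open>qrel\<close> is the space of relations, a graded subspace of the weight two part of the free operad.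
\<close>

record (overloaded) ('e, 'k) quadratic_data =
  qarity :: "'e \<Rightarrow> nat"
  qdegree :: "'e \<Rightarrow> int"
  qrel :: "('e ptree \<Rightarrow>\<^sub>0 'k) set"

text \<open>
  The quadratic cooperad \<open>\<C>(E,R)\<close>, the universal (that is, largest) sub-cooperad \<open>D\<close> of the cofree
  conilpotent cooperad on \<open>E\<close> such that \<open>D\<close> maps to zero in the quotient of the weight two part
  by \<open>R\<close>.  It is the sum of all such sub-cooperads.
\<close>

definition quadratic_cooperad :: "('e, 'k::field) quadratic_data \<Rightarrow> ('e ptree, 'k) ns_cooperad" where
  "quadratic_cooperad Q =
    (let F = cofree_cooperad (qarity Q) (qdegree Q) in
     F \<lparr> co_part := (\<lambda>n d. pm.span (\<Union>{D n d | D. sub_cooperad F D \<and>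
                        (\<forall>n d. \<forall>x\<in>D n d. weight_part 2 x \<in> qrel Q)})) \<rparr>)"

lemma lookup_lin_extend: "lookup (lin_extend F x) c = (\<Sum>b\<in>keys x. lookup x b * lookup (F b) c)"
  by (simp add: lin_extend_def lookup_sum lookup_smul)

lemma lookup_lin_extend_superset:
  assumes "finite A" "keys x \<subseteq> A"
  shows "lookup (lin_extend F x) c = (\<Sum>b\<in>A. lookup x b * lookup (F b) c)"
  unfolding lookup_lin_extend
  by (rule sum.mono_neutral_left) (use assms in \<open>auto simp: in_keys_iff\<close>)

lemma linear_lin_extend: "Vector_Spaces.linear smul smul (lin_extend F)"
proof (unfold_locales, goal_cases)
  case (1 x y)
  let ?A = "keys x \<union> keys y"
  have "finite ?A" "keys (x + y) \<subseteq> ?A"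
    by (auto dest: set_mp[OF Poly_Mapping.keys_add])
  then show ?case
    by (intro poly_mapping_eqI)
       (simp add: lookup_add lookup_lin_extend_superset[of ?A] sum.distrib distrib_right)
next
  case (2 c x)
  have "keys (smul c x) \<subseteq> keys x"
    by (auto simp: in_keys_iff lookup_smul)
  then show ?case
    by (intro poly_mapping_eqI)
       (simp add: lookup_smul lookup_lin_extend_superset[of "keys x"] sum_distrib_left mult.assoc)
qed

lemma lookup_weight_part: "lookup (weight_part w x) t = (if weight t = w then lookup x t else 0)"
  by (auto simp: weight_part_def lookup_sum lookup_single when_def in_keys_iff)

lemma linear_weight_part: "Vector_Spaces.linear smul smul (weight_part w)"
  by unfold_locales
     (auto intro!: poly_mapping_eqI simp: lookup_weight_part lookup_add lookup_smul)

lemma subspace_tree_part: "pm.subspace (tree_part ar dg n d)"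
  by (auto simp: pm.subspace_def tree_part_def in_keys_iff lookup_add lookup_smul)

lemma quadratic_cooperad_greatest:
  fixes Q :: "('e, 'k::field) quadratic_data"
  assumes R: "pm.subspace (qrel Q)"
  defines "F \<equiv> cofree_cooperad (qarity Q) (qdegree Q)"
  defines "K \<equiv> co_part (quadratic_cooperad Q)"
  shows "sub_cooperad F K"
    and "x \<in> K n d \<Longrightarrow> weight_part 2 x \<in> qrel Q"
    and "sub_cooperad F D \<Longrightarrow> (\<And>n d x. x \<in> D n d \<Longrightarrow> weight_part 2 x \<in> qrel Q) \<Longrightarrow> D n d \<subseteq> K n d"
proof -
  let ?ok = "\<lambda>D. sub_cooperad F D \<and> (\<forall>n d. \<forall>x\<in>D n d. weight_part 2 x \<in> qrel Q)"
  let ?T = "\<lambda>D. {boxtensor i y z | i k p m q y z. 1 \<le> i \<and> i \<le> k \<and> y \<in> D k p \<and> z \<in> D m q}"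
  have K: "K n d = pm.span (\<Union>{D n d | D. ?ok D})" for n d
    by (simp add: K_def F_def quadratic_cooperad_def Let_def)
  show sub: "D n d \<subseteq> K n d"
    if "sub_cooperad F D" "\<And>n d x. x \<in> D n d \<Longrightarrow> weight_part 2 x \<in> qrel Q" for D n d
    unfolding K using that by (intro subset_trans[OF _ pm.span_superset]) blast
  interpret wp: Vector_Spaces.linear smul smul "weight_part 2 :: ('e ptree \<Rightarrow>\<^sub>0 'k) \<Rightarrow> _"
    by (rule linear_weight_part)
  interpret dc: Vector_Spaces.linear smul smul "dec F"
    unfolding dec_def by (rule linear_lin_extend)
  show "weight_part 2 x \<in> qrel Q" if "x \<in> K n d" for x n d
    using that unfolding K
  proof (induction rule: pm.span_induct)
    case base
    show ?case
      using R by (auto simp: pm.subspace_def wp.add wp.scale wp.zero)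
  qed auto
  have part: "K n d \<subseteq> co_part F n d" for n d
  proof -
    have "co_part F n d = tree_part (qarity Q) (qdegree Q) n d"
      by (simp add: F_def cofree_cooperad_def)
    then show ?thesis
      unfolding K by (intro pm.span_minimal) (auto simp: sub_cooperad_def subspace_tree_part)
  qed
  have "dec F x \<in> pm.span (?T K)" if "x \<in> K n d" for x n d
    using that unfolding K
  proof (induction rule: pm.span_induct)
    case base
    show ?case
      by (auto simp: pm.subspace_def dc.add dc.scale dc.zero pm.span_add pm.span_scale pm.span_zero)
  next
    case (step x)
    then obtain D where D: "?ok D" "x \<in> D n d"
      by auto
    then have le: "D n d \<subseteq> K n d" for n d
      using sub by blast
    have "dec F x \<in> pm.span (?T D)"
      using D unfolding sub_cooperad_def by blast
    also have "pm.span (?T D) \<subseteq> pm.span (?T K)"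
      using le by (intro pm.span_mono) blast
    finally show ?case
      unfolding K .
  qed
  moreover have "pm.subspace (K n d)" for n d
    unfolding K by simp
  ultimately show "sub_cooperad F K"
    using part unfolding sub_cooperad_def by blast
qed

text \<open>
  The data \<open>(sE, s\<^sup>2R)\<close>.  A basis element \<open>e\<close> of \<open>E\<close> also denotes the basis element \<open>se\<close> of \<open>sE\<close>; the
  Koszul sign of \<open>(s \<otimes> s)(u \<otimes> v) = (-1)\<^bsup>|u|\<^esup> su \<otimes> sv\<close> involves the degree of the root vertex \<open>u\<close>.
\<close>

definition root_degree :: "('e \<Rightarrow> int) \<Rightarrow> 'e ptree \<Rightarrow> int" where
  "root_degree dg t = (case t of Leaf \<Rightarrow> 0 | Node e ts \<Rightarrow> dg e)"

definition suspend :: "('e, 'k::field) quadratic_data \<Rightarrow> ('e, 'k) quadratic_data" where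
  "suspend Q =
    \<lparr> qarity = qarity Q,
      qdegree = (\<lambda>e. qdegree Q e + 1),
      qrel = lin_extend (\<lambda>t. Poly_Mapping.single t (ksign (root_degree (qdegree Q) t))) ` qrel Q \<rparr>"

definition koszul_dual_cooperad ::
  "('e, 'k::field) quadratic_data \<Rightarrow> ('e ptree, 'k) ns_cooperad" where
  "koszul_dual_cooperad Q = quadratic_cooperad (suspend Q)"

text \<open>The cooperad \<open>\<S>\<^sup>c\<close>; the basis element \<open>n \<ge> 1\<close> is \<open>\<beta>\<^sub>n\<close>.\<close>

definition suspension_cooperad :: "(nat, 'k::field) ns_cooperad" where
  "suspension_cooperad =
    \<lparr> barity = (\<lambda>n. n),
      bdegree = (\<lambda>n. 1 - int n),
      co_part = (\<lambda>n d. {x. \<forall>j\<in>keys x. 1 \<le> j \<and> j = n \<and> 1 - int j = d}),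
      bdec = (\<lambda>n. \<Sum>(p, q, r)\<in>{(p, q, r). 1 \<le> q \<and> p + q + r = n}.
                 Poly_Mapping.single (p + r + 1, p + 1, q) (ksign (int p * (int q - 1)))),
      bcounit = (\<lambda>n. if n = 1 then 1 else 0) \<rparr>"

definition hadamard ::
  "('a, 'k::field) ns_cooperad \<Rightarrow> ('b, 'k) ns_cooperad \<Rightarrow> ('a \<times> 'b, 'k) ns_cooperad" where
  "hadamard C D =
    \<lparr> barity = (\<lambda>(a, b). barity C a),
      bdegree = (\<lambda>(a, b). bdegree C a + bdegree D b),
      co_part = (\<lambda>n d. pm.span
        {\<Sum>a\<in>keys x. \<Sum>b\<in>keys y. Poly_Mapping.single (a, b) (lookup x a * lookup y b) | x y p q.
           x \<in> co_part C n p \<and> y \<in> co_part D n q \<and> p + q = d}),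
      bdec = (\<lambda>(a, b).
        \<Sum>((a1, i, a2), (b1, j, b2))\<in>{((a1, i, a2), (b1, j, b2)).
             (a1, i, a2) \<in> keys (bdec C a) \<and> (b1, j, b2) \<in> keys (bdec D b) \<and>
             i = j \<and> barity C a1 = barity D b1 \<and> barity C a2 = barity D b2}.
          Poly_Mapping.single ((a1, b1), i, (a2, b2))
            (ksign (bdegree C a2 * bdegree D b1) *
             lookup (bdec C a) (a1, i, a2) * lookup (bdec D b) (b1, j, b2))),
      bcounit = (\<lambda>(a, b). bcounit C a * bcounit D b) \<rparr>"

text \<open>The component of the infinitesimal decomposition of \<open>x\<close> in \<open>C(n) \<boxtimes>\<^sub>i C(m)\<close>.\<close>

definition dec_at ::
  "('b, 'k::field) ns_cooperad \<Rightarrow> nat \<Rightarrow> nat \<Rightarrow> nat \<Rightarrow> ('b \<Rightarrow>\<^sub>0 'k) \<Rightarrow> ('b \<times> nat \<times> 'b \<Rightarrow>\<^sub>0 'k)" where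
  "dec_at C n i m x =
    (\<Sum>(a, j, b)\<in>{(a, j, b). (a, j, b) \<in> keys (dec C x) \<and> barity C a = n \<and> j = i \<and> barity C b = m}.
       Poly_Mapping.single (a, j, b) (lookup (dec C x) (a, j, b)))"

text \<open>
  The functional \<open>f \<otimes> g\<close> on \<open>C(n) \<boxtimes>\<^sub>i C(m)\<close> for \<open>f \<in> C(n)\<^sup>*\<close> and \<open>g \<in> C(m)\<^sup>*\<close>, i.e. the unique linear one
  with \<open>(f \<otimes> g)(y \<otimes> z) = (-1)\<^bsup>|g||y|\<^esup> f(y) g(z)\<close>.  Since \<open>g(z)\<close> vanishes unless \<open>|g| = -|z|\<close>, the
  sign can be written \<open>(-1)\<^bsup>|y||z|\<^esup>\<close>, which also covers inhomogeneous \<open>f\<close> and \<open>g\<close>.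
\<close>

definition tensor_functional ::
  "('b, 'k::field) ns_cooperad \<Rightarrow> nat \<Rightarrow> nat \<Rightarrow> nat \<Rightarrow> (('b \<Rightarrow>\<^sub>0 'k) \<Rightarrow> 'k) \<Rightarrow> (('b \<Rightarrow>\<^sub>0 'k) \<Rightarrow> 'k) \<Rightarrow>
     ('b \<times> nat \<times> 'b \<Rightarrow>\<^sub>0 'k) \<Rightarrow> 'k" where
  "tensor_functional C n i m f g w =
    (THE c. \<exists>T. Vector_Spaces.linear smul (*) T \<and>
       (\<forall>p q. \<forall>y\<in>co_part C n p. \<forall>z\<in>co_part C m q.
          T (boxtensor i y z) = ksign (p * q) * f y * g z) \<and>
       T w = c)"

text \<open>
  The arity-wise graded linear dual.  A functional on \<open>C(n)\<close> is represented by its extension by zero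
  (not a linear extension) to the ambient space.
\<close>

definition linear_dual :: "('b, 'k::field) ns_cooperad \<Rightarrow> (('b \<Rightarrow>\<^sub>0 'k) \<Rightarrow> 'k, 'k) ns_operad" where
  "linear_dual C =
    \<lparr> op_part = (\<lambda>n d. {f.
        (\<forall>x. x \<notin> co_arity C n \<longrightarrow> f x = 0) \<and>
        (\<forall>x\<in>co_arity C n. \<forall>y\<in>co_arity C n. f (x + y) = f x + f y) \<and>
        (\<forall>c. \<forall>x\<in>co_arity C n. f (smul c x) = c * f x) \<and>
        (\<forall>e. e \<noteq> - d \<longrightarrow> (\<forall>x\<in>co_part C n e. f x = 0))}),
      scl = (\<lambda>c f x. c * f x),
      pcomp = (\<lambda>n i m f g x. if x \<in> co_arity C (n + m - 1)
                 then tensor_functional C n i m f g (dec_at C n i m x) else 0),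
      ident = (\<lambda>x. if x \<in> co_arity C 1 then counit C x else 0) \<rparr>"

definition koszul_dual_operad ::
  "('e, 'k::field) quadratic_data \<Rightarrow> ((nat \<times> 'e ptree \<Rightarrow>\<^sub>0 'k) \<Rightarrow> 'k, 'k) ns_operad" where
  "koszul_dual_operad Q = linear_dual (hadamard suspension_cooperad (koszul_dual_cooperad Q))"


section \<open>The AsGDer operad\<close>

datatype agd_gen = GenH | GenD | GenMu

primrec agd_arity :: "agd_gen \<Rightarrow> nat" where
  "agd_arity GenH = 1"
| "agd_arity GenD = 1"
| "agd_arity GenMu = 2"

definition agd_degree :: "agd_gen \<Rightarrow> int" where
  "agd_degree e = 0"

definition gen :: "agd_gen \<Rightarrow> (agd_gen ptree \<Rightarrow>\<^sub>0 'k::field)" where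
  "gen e = Poly_Mapping.single (corolla agd_arity e) 1"

definition agd_circ ::
  "agd_gen \<Rightarrow> nat \<Rightarrow> agd_gen \<Rightarrow> (agd_gen ptree \<Rightarrow>\<^sub>0 'k::field)" where
  "agd_circ u i v =
     pcomp (free_operad agd_arity agd_degree) (agd_arity u) i (agd_arity v) (gen u) (gen v)"

text \<open>The presentation \<open>(E, R)\<close> of the AsGDer operad \<open>\<F>(E)/(R)\<close>.\<close>

definition AsGDer :: "(agd_gen, 'k::field) quadratic_data" where
  "AsGDer =
    \<lparr> qarity = agd_arity,
      qdegree = agd_degree,
      qrel = pm.span
        {agd_circ GenMu 1 GenMu - agd_circ GenMu 2 GenMu,
         agd_circ GenH 1 GenMu - agd_circ GenMu 1 GenH - agd_circ GenMu 2 GenH,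
         agd_circ GenD 1 GenMu - agd_circ GenMu 1 GenD - agd_circ GenMu 2 GenH} \<rparr>"

end

theory Submission
  imports Defs
begin

text \<open>
  Evaluating a planar tree on \<open>h, \<delta>, \<mu>\<close> in the operad of the theorem gives, up to signs, three coefficient
  functions on trees.  Compatibility of the evaluation with grafting says that these functions, seen
  as elements of the cofree cooperad, span a sub-cooperad whose weight two part consists of relations;
  hence they lie in the Koszul dual cooperad.  Conversely the sub-cooperad property and the weight
  two relations allow one to rewrite every tree, inside the Koszul dual cooperad, to a combination of
  left combs of \<open>\<mu>\<close>'s with at most one \<open>h\<close> or \<open>\<delta>\<close> at the root: an element whose coefficients at these normal
  forms vanish is zero.  So the Koszul dual cooperad has exactly three basis elements in each arity,
  and the partial compositions are read off their decompositions.
\<close>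

section \<open>Decompositions of trees\<close>

text \<open>The recursion for \<open>coef\<close> transposes the composition table of the theorem.
  Composing \<mu> with h in a slot other than the first gives \<delta> + h, and with \<delta> gives
  0, so both the h- and the \<delta>-coefficient of a \<mu>-rooted tree draw on the h-coefficient of
  its right branch; hence the replacement of \<open>KD\<close> by \<open>KH\<close>. Composites of
  two unary elements vanish, so a nonzero coefficient allows at most one unary vertex and ties
  weight to arity. After suspension the degree is the weight, so the same relation decides Koszul
  signs by parity.

  The greatest sub-cooperad has no explicit description, and the relations constrain weight two
  only. The bridge to higher weight is that a coefficient at a grafting is, up to sign, a
  coefficient of the decomposition, hence of a combination of tensors of elements of the dual.
  Induction on weight applies to both tensor factors as soon as each grafted part contains a vertex;
  presenting trees as such graftings is the combinatorial core.\<close>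

lemma ksign_square: "ksign a * ksign a = (1 :: 'k::field)"
  by (simp add: ksign_def)

lemma ksign_nonzero: "ksign a \<noteq> (0 :: 'k::field)"
  by (simp add: ksign_def)

lemma lookup_boxtensor:
  "lookup (boxtensor i x y) (a, j, b) = (if i = j then lookup x a * lookup y b else 0)"
proof -
  have "lookup (boxtensor i x y) (a, j, b) =
    (\<Sum>a'\<in>keys x. if a' = a then \<Sum>b'\<in>keys y. if b' = b \<and> i = j then lookup x a * lookup y b else 0 else 0)"
    unfolding boxtensor_def lookup_sum
    by (intro sum.cong refl) (auto simp: lookup_single when_def intro!: sum.cong)
  also have "\<dots> = (if i = j then lookup x a * lookup y b else 0)"
    by (auto simp: sum.delta in_keys_iff cong: if_cong)
  finally show ?thesis .
qed

lemma graft_list_Nil_iff: "graft_list ts i s = [] \<longleftrightarrow> ts = []"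
  by (cases ts) auto

text \<open>\<open>cofree_cooperad\<close> sums over this set, and a sum over an infinite set would
  be 0 by convention. For finiteness: either the lower tree is \<open>Leaf\<close>, or it shares its
  root with \<open>t\<close> and the grafting happens inside one child.\<close>

lemma finite_grafts:
  fixes t :: "'e ptree"
  shows "finite {(a, i, b). 1 \<le> i \<and> i \<le> leaves a \<and> graft a i b = t}"
proof (induction t)
  case Leaf
  have "a = Leaf \<and> i = 1 \<and> b = Leaf" if "1 \<le> i" "i \<le> leaves a" "graft a i b = Leaf"
    for a :: "'e ptree" and i b
    using that by (cases a) auto
  then have "{(a, i, b). 1 \<le> i \<and> i \<le> leaves a \<and> graft a i b = Leaf} \<subseteq> {(Leaf :: 'e ptree, 1, Leaf)}"
    by blast
  then show ?case by (rule finite_subset) simp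
next
  case (Node e ts)
  have fin: "finite {(as, i, b). 1 \<le> i \<and> i \<le> sum_list (map leaves as) \<and> graft_list as i b = ts}"
    (is "finite (?S ts)")
    using Node
  proof (induction ts)
    case Nil
    have empty: "?S [] = {}" by (auto simp: graft_list_Nil_iff)
    show ?case unfolding empty by simp
  next
    case (Cons t ts)
    let ?G = "{(a, i, b). 1 \<le> i \<and> i \<le> leaves a \<and> graft a i b = t}"
    have fin: "finite ?G" "finite (?S ts)" using Cons by auto
    have "(as, i, b) \<in> (\<lambda>(a, i, b). (a # ts, i, b)) ` ?G \<union>
        (\<lambda>(as, i, b). (t # as, i + leaves t, b)) ` ?S ts"
      if *: "1 \<le> i" "i \<le> sum_list (map leaves as)" "graft_list as i b = t # ts" for as i b
    proof -
      from * obtain a as' where as: "as = a # as'" by (cases as) auto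
      show ?thesis
      proof (cases "i \<le> leaves a")
        case True
        with * as show ?thesis by (auto intro!: image_eqI[of _ _ "(a, i, b)"])
      next
        case False
        with * as show ?thesis by (auto intro!: image_eqI[of _ _ "(as', i - leaves a, b)"])
      qed
    qed
    then have "?S (t # ts) \<subseteq> (\<lambda>(a, i, b). (a # ts, i, b)) ` ?G \<union>
        (\<lambda>(as, i, b). (t # as, i + leaves t, b)) ` ?S ts"
      by blast
    then show ?case by (rule finite_subset) (use fin in auto)
  qed
  have "(a, i, b) \<in> insert (Leaf, 1, Node e ts) ((\<lambda>(as, i, b). (Node e as, i, b)) ` ?S ts)"
    if "1 \<le> i" "i \<le> leaves a" "graft a i b = Node e ts" for a i b
    using that by (cases a) auto
  then have "{(a, i, b). 1 \<le> i \<and> i \<le> leaves a \<and> graft a i b = Node e ts} \<subseteq>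
     insert (Leaf, 1, Node e ts) ((\<lambda>(as, i, b). (Node e as, i, b)) ` ?S ts)"
    by blast
  then show ?case by (rule finite_subset) (use fin in auto)
qed

lemma leaves_graft:
  "1 \<le> i \<Longrightarrow> i \<le> leaves a \<Longrightarrow> leaves (graft a i b) + 1 = leaves a + leaves b"
  "1 \<le> i \<Longrightarrow> i \<le> sum_list (map leaves as) \<Longrightarrow>
     sum_list (map leaves (graft_list as i b)) + 1 = sum_list (map leaves as) + leaves b"
  by (induction a i b and as i b rule: graft_graft_list.induct) (auto split: if_splits)

lemma weight_graft:
  "1 \<le> i \<Longrightarrow> i \<le> leaves a \<Longrightarrow> weight (graft a i b) = weight a + weight b"
  "1 \<le> i \<Longrightarrow> i \<le> sum_list (map leaves as) \<Longrightarrow>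
     sum_list (map weight (graft_list as i b)) = sum_list (map weight as) + weight b"
  by (induction a i b and as i b rule: graft_graft_list.induct) (auto split: if_splits)

text \<open>A triple \<open>(a, i, b)\<close> occurs only in the decomposition of the one tree
  \<open>graft a i b\<close>, so each coefficient of the decomposition is a single coefficient of
  \<open>x\<close> up to sign.\<close>

lemma lookup_dec_cofree:
  fixes x :: "'e ptree \<Rightarrow>\<^sub>0 'k::field"
  shows "lookup (dec (cofree_cooperad ar dg) x) (a, i, b) =
    (if 1 \<le> i \<and> i \<le> leaves a then graft_sign dg a i b * lookup x (graft a i b) else 0)"
proof -
  have bdec: "lookup (bdec (cofree_cooperad ar dg) t) (a, i, b) =
      (if 1 \<le> i \<and> i \<le> leaves a \<and> graft a i b = t then graft_sign dg a i b else (0::'k))" for t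
  proof -
    let ?S = "{(a, i, b). 1 \<le> i \<and> i \<le> leaves a \<and> graft a i b = t}"
    have "lookup (bdec (cofree_cooperad ar dg) t) (a, i, b) =
       (\<Sum>z\<in>?S. if z = (a, i, b) then graft_sign dg a i b else (0::'k))"
      unfolding cofree_cooperad_def
      by (auto simp: lookup_sum lookup_single when_def split_beta intro!: sum.cong)
    also have "\<dots> = (if (a, i, b) \<in> ?S then graft_sign dg a i b else 0)"
      by (subst sum.delta[OF finite_grafts]) simp
    finally show ?thesis by simp
  qed
  show ?thesis
    unfolding dec_def lookup_lin_extend bdec
    by (auto simp: if_distrib sum.delta in_keys_iff cong: if_cong)
qed

section \<open>Cooperad elements from tree coefficients\<close>

lemma leaves_pos: "wf_tree agd_arity t \<Longrightarrow> 1 \<le> leaves t"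
proof (induction t)
  case (Node e ts)
  then show ?case by (cases e) (auto simp: Suc_le_eq length_Suc_conv numeral_2_eq_2)
qed auto

section \<open>Tree coefficients and their behaviour under grafting\<close>

datatype kind = KMu | KH | KD

lemma UNIV_kind: "UNIV = {KMu, KH, KD}"
  using kind.exhaust by auto

lemma sum_kind: "sum f (UNIV :: kind set) = f KMu + (f KH + f KD)"
  by (simp add: UNIV_kind)

instance kind :: finite
  by standard (simp add: UNIV_kind)

text \<open>The number of unary vertices in any tree on which \<open>coef k\<close> is nonzero.
  After tensoring with \<open>suspension_cooperad\<close> it becomes the degree of the basis
  element.\<close>

definition kdeg :: "kind \<Rightarrow> nat" where
  "kdeg k = (if k = KMu then 0 else 1)"

text \<open>
  \<open>coef k t\<close> is, up to sign, the coefficient at \<open>\<mu>\<^sub>n\<close>, \<open>h\<^sub>n\<close> or \<open>\<delta>\<^sub>n\<close> of the value of \<open>t\<close> in the operad described by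
  the theorem.  The signs are those of the operadic suspension, normalised so that they disappear
  after the Hadamard product with \<open>\<S>\<^sup>c\<close>.
\<close>

fun coef :: "kind \<Rightarrow> agd_gen ptree \<Rightarrow> 'k::field" where
  "coef k Leaf = (if k = KMu then 1 else 0)"
| "coef k (Node GenH [s]) = (if k = KH then ksign (int (leaves s) + 1) * coef KMu s else 0)"
| "coef k (Node GenD [s]) = (if k = KD then ksign (int (leaves s) + 1) * coef KMu s else 0)"
| "coef k (Node GenMu [s, t]) =
     ksign (int (leaves s) + 1) * coef KMu s * coef (if k = KD then KH else k) t
     + (if k = KMu then 0 else ksign (int (leaves s) + int (leaves t)) * coef k s * coef KMu t)"
| "coef k _ = 0"

text \<open>A binary vertex adds one leaf and a unary vertex none, so the number of unary vertices
  is weight minus leaves plus one; the recursion admits exactly \<open>kdeg k\<close> of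
  them.\<close>

lemma coef_support:
  "coef k t \<noteq> (0::'k::field) \<Longrightarrow> wf_tree agd_arity t \<and> weight t + 1 = leaves t + kdeg k"
proof (induction k t rule: coef.induct)
  case (4 k s t)
  have "x \<noteq> 0 \<or> y \<noteq> 0" if "x + y \<noteq> 0" for x y :: 'k using that by auto
  from this[OF 4(5)[unfolded coef.simps]] 4(1-4) show ?case
    by (auto simp: kdeg_def split: if_splits)
qed (auto simp: kdeg_def split: if_splits)

lemma coef_eq_0: "weight t + 1 \<noteq> leaves t + kdeg k \<Longrightarrow> coef k t = 0"
  using coef_support by blast

lemma tdegree_eq_weight: "tdegree (\<lambda>_. 1) t = int (weight t)"
proof (induction t)
  case (Node e ts)
  then show ?case by (induction ts) auto
qed simp

text \<open>The weight tells how many unary vertices a tree has, so the \<open>KMu\<close>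
  coefficient and the unary ones are never both nonzero. Each case records the parity that sign
  computations need.\<close>

lemma coef_cases:
  obtains (mu) "\<And>k. k \<noteq> KMu \<Longrightarrow> coef k t = (0::'k::field)" "even (weight t) \<longleftrightarrow> odd (leaves t)"
  | (unary) "coef KMu t = (0::'k)" "even (weight t) \<longleftrightarrow> even (leaves t)"
  | (zero) "\<And>k. coef k t = (0::'k)"
proof -
  consider "weight t + 1 = leaves t" | "weight t = leaves t"
    | "weight t + 1 \<noteq> leaves t" "weight t \<noteq> leaves t" by blast
  then show thesis
  proof cases
    case 1
    show ?thesis
    proof (rule mu)
      show "coef k t = (0::'k)" if "k \<noteq> KMu" for k
        using 1 that by (intro coef_eq_0) (auto simp: kdeg_def)
      show "even (weight t) \<longleftrightarrow> odd (leaves t)"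
        using 1 by presburger
    qed
  next
    case 2
    then show ?thesis by (intro unary) (auto intro!: coef_eq_0 simp: kdeg_def)
  next
    case 3
    then show ?thesis by (intro zero coef_eq_0) (auto simp: kdeg_def)
  qed
qed

lemma even_leaves_graft:
  assumes "1 \<le> i" "i \<le> leaves s"
  shows "even (leaves (graft s i t)) \<longleftrightarrow> odd (leaves s + leaves t)"
  using leaves_graft(1)[OF assms, of t] by presburger

text \<open>This is the composition table in transposed form: the unary vertex, if there is one,
  lies in \<open>t\<close> (first summand) or in \<open>s\<close> (second summand).
  \<open>graft_sign\<close> is the sign of the cofree cooperad; the remaining signs are those that
  the Hadamard product will cancel. The induction follows the \<open>i\<close>-th leaf down through
  \<open>s\<close>.\<close>

lemma coef_graft:
  assumes "1 \<le> i" "i \<le> leaves s"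
  shows "coef k (graft s i t) = graft_sign (\<lambda>_. 1) s i t *
    (ksign ((int (leaves t) + 1) * (int i + int (leaves s))) *
       coef KMu s * coef (if k = KD \<and> i \<noteq> 1 then KH else k) t +
     (if k = KMu then 0 else
     ksign ((int (leaves t) + 1) * (int i + int (leaves s) + 1)) * coef k s * coef KMu t) :: 'k::field)"
  using assms
proof (induction k s arbitrary: i rule: coef.induct)
  case (1 k)
  then have "i = 1" by simp
  then show ?case by (simp add: graft_sign_def ksign_def)
next
  case (2 k s)
  then show ?case using 2(1)[of i] even_leaves_graft[of i s t] by (auto simp: graft_sign_def ksign_def)
next
  case (3 k s)
  then show ?case using 3(1)[of i] even_leaves_graft[of i s t] by (auto simp: graft_sign_def ksign_def)
next
  case (4 k s1 s2)
  have i: "1 \<le> i" using 4 by auto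
  show ?case
  proof (cases "i \<le> leaves s1")
    case True
    note l = even_leaves_graft[OF i True, of t]
    note IH = 4(1)[OF i True] 4(3)[OF _ i True]
    show ?thesis
    proof (cases "k = KMu")
      case k: True
      \<comment> \<open>The branch \<open>s2\<close> comes after the grafting leaf, so its degree
        enters \<open>graft_sign\<close>; the case split fixes the parities of \<open>s2\<close> and
        \<open>t\<close>.\<close>
      show ?thesis using IH(1) l k True
        by (cases s2 rule: coef_cases[where 'k='k]; cases t rule: coef_cases[where 'k='k])
          (auto simp: graft_sign_def tdegree_eq_weight ksign_def)
    next
      case k: False
      show ?thesis using IH(1) IH(2)[OF k] l k True
        by (cases s2 rule: coef_cases[where 'k='k]; cases t rule: coef_cases[where 'k='k])
          (auto simp: graft_sign_def tdegree_eq_weight ksign_def)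
    qed
  next
    case False
    with i 4 have j: "1 \<le> i - leaves s1" "i - leaves s1 \<le> leaves s2" by auto
    note l = even_leaves_graft[OF j, of t]
    note IH = 4(2)[OF j] 4(4)[OF _ j]
    define d where "d = i - leaves s1"
    have di: "i = d + leaves s1" using j by (simp add: d_def)
    have d: "int d = int i - int (leaves s1)" using j by (simp add: d_def)
    \<comment> \<open>Arbitrary trees may lack leaves. A leaf in \<open>s1\<close> is what
      guarantees \<open>i \<noteq> 1\<close> here, so that the claim reads \<open>KH\<close> in
      place of \<open>KD\<close>, as the recursion does.\<close>
    show ?thesis
    proof (cases "leaves s1 = 0")
      case True
      then have "coef j s1 = (0::'k)" for j
        using coef_support[of j s1, where 'k='k] leaves_pos[of s1] by force
      then show ?thesis using False by simp
    next
      case s1: False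
      show ?thesis
      proof (cases "k = KMu")
        case k: True
        show ?thesis using IH(1) l k False s1 j unfolding d_def[symmetric]
          by (auto simp: graft_sign_def tdegree_eq_weight ksign_def di)
      next
        case k: False
        show ?thesis using IH(1) IH(2)[OF k] l k False s1 j unfolding d_def[symmetric]
          by (auto simp: graft_sign_def tdegree_eq_weight ksign_def di algebra_simps)
      qed
    qed
  qed
qed (auto split: if_splits)

section \<open>The candidate basis and its decomposition\<close>

instance agd_gen :: finite
proof
  have U: "(UNIV :: agd_gen set) = {GenH, GenD, GenMu}" using agd_gen.exhaust by auto
  show "finite (UNIV :: agd_gen set)" unfolding U by simp
qed

lemma wf_tree_cases:
  assumes "wf_tree agd_arity t"
  obtains "t = Leaf"
  | u s where "u \<noteq> GenMu" "t = Node u [s]" "wf_tree agd_arity s"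
  | s1 s2 where "t = Node GenMu [s1, s2]" "wf_tree agd_arity s1" "wf_tree agd_arity s2"
proof (cases t)
  case (Node e ts)
  then show thesis using assms that
    by (cases e) (auto simp: length_Suc_conv numeral_2_eq_2)
qed (use that in auto)

text \<open>Unary vertices leave the arity unchanged, so infinitely many trees share an arity; only
  a bound on the weight yields the finite support required for \<open>cobasis\<close>.\<close>

lemma finite_wf_trees: "finite {t. wf_tree agd_arity t \<and> weight t \<le> w}"
proof (induction w)
  case 0
  have "{t. wf_tree agd_arity t \<and> weight t \<le> 0} \<subseteq> {Leaf}"
    by (auto elim: wf_tree_cases)
  then show ?case by (rule finite_subset) simp
next
  case (Suc w)
  let ?S = "{t. wf_tree agd_arity t \<and> weight t \<le> w}"
  have "t \<in> insert Leaf ((\<lambda>(u, s). Node u [s]) ` (UNIV \<times> ?S) \<union>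
     (\<lambda>(s1, s2). Node GenMu [s1, s2]) ` (?S \<times> ?S))"
    if "wf_tree agd_arity t" "weight t \<le> Suc w" for t
    using that(1) by (cases rule: wf_tree_cases) (use that in auto)
  then have "{t. wf_tree agd_arity t \<and> weight t \<le> Suc w} \<subseteq>
     insert Leaf ((\<lambda>(u, s). Node u [s]) ` (UNIV \<times> ?S) \<union> (\<lambda>(s1, s2). Node GenMu [s1, s2]) ` (?S \<times> ?S))"
    by blast
  then show ?case by (rule finite_subset) (use Suc in auto)
qed

lift_definition cobasis :: "kind \<Rightarrow> nat \<Rightarrow> (agd_gen ptree \<Rightarrow>\<^sub>0 'k::field)" is
  "\<lambda>k n t. if leaves t = n then coef k t else 0"
proof -
  fix k n
  have "{t. (if leaves t = n then coef k t else (0::'k)) \<noteq> 0} \<subseteq>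
      {t. wf_tree agd_arity t \<and> weight t \<le> n + 1}"
    using coef_support[where 'k='k, of k] by (force simp: kdeg_def split: if_splits)
  then show "finite {t. (if leaves t = n then coef k t else (0::'k)) \<noteq> 0}"
    by (rule finite_subset) (rule finite_wf_trees)
qed

lemma lookup_cobasis: "lookup (cobasis k n) t = (if leaves t = n then coef k t else 0)"
  by transfer simp

fun left_comb :: "nat \<Rightarrow> agd_gen ptree" where
  "left_comb 0 = Leaf"
| "left_comb (Suc j) = Node GenMu [left_comb j, Leaf]"

text \<open>A comb with \<open>n\<close> leaves has \<open>n - 1\<close> vertices. For
  \<open>n = 0\<close> truncated subtraction still yields one leaf, which is why the facts on arity
  and weight assume \<open>1 \<le> n\<close>.\<close>

primrec canon :: "kind \<Rightarrow> nat \<Rightarrow> agd_gen ptree" where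
  "canon KMu n = left_comb (n - 1)"
| "canon KH n = Node GenH [left_comb (n - 1)]"
| "canon KD n = Node GenD [left_comb (n - 1)]"

lemma leaves_left_comb [simp]: "leaves (left_comb j) = Suc j"
  by (induction j) auto

lemma weight_left_comb [simp]: "weight (left_comb j) = j"
  by (induction j) auto

lemma leaves_canon: "1 \<le> n \<Longrightarrow> leaves (canon k n) = n"
  by (cases k) auto

lemma weight_canon: "1 \<le> n \<Longrightarrow> weight (canon k n) + 1 = n + kdeg k"
  by (cases k) (auto simp: kdeg_def)

lemma coef_left_comb: "coef KMu (left_comb j) \<noteq> (0::'k::field)"
  by (induction j) (auto simp: ksign_nonzero)

lemma coef_left_comb_unary: "k \<noteq> KMu \<Longrightarrow> coef k (left_comb j) = (0::'k::field)"
  by (rule coef_eq_0) (auto simp: kdeg_def)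

text \<open>Up to nonzero factors the coefficient functions are dual to the normal forms, so values
  at normal forms serve as coordinates and the three elements of an arity are independent.\<close>

lemma coef_canon_eq_0_iff: "coef k (canon k' n) = (0::'k::field) \<longleftrightarrow> k \<noteq> k'"
  by (cases k; cases k') (auto simp: coef_left_comb coef_left_comb_unary ksign_nonzero)

abbreviation agd_cofree :: "(agd_gen ptree, 'k::field) ns_cooperad" where
  "agd_cofree \<equiv> cofree_cooperad agd_arity (\<lambda>_. 1)"

text \<open>Each generator of \<open>sE\<close> has degree 1, so the degree of
  \<open>cobasis k n\<close> is its number of vertices: \<open>n - 1\<close> binary ones and
  \<open>kdeg k\<close> unary ones.\<close>

definition agd_span :: "nat \<Rightarrow> int \<Rightarrow> (agd_gen ptree \<Rightarrow>\<^sub>0 'k::field) set" where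
  "agd_span n d = pm.span {cobasis k n | k. 1 \<le> n \<and> d = int n - 1 + int (kdeg k)}"

lemma cobasis_in_agd_span: "1 \<le> n \<Longrightarrow> (cobasis k n :: _ \<Rightarrow>\<^sub>0 'k::field) \<in> agd_span n (int n - 1 + int (kdeg k))"
  unfolding agd_span_def by (rule pm.span_base) auto

lemma coef_not_wf: "\<not> wf_tree agd_arity t \<Longrightarrow> coef k t = (0::'k::field)"
  using coef_support by blast

lemma coef_no_leaves: "leaves t = 0 \<Longrightarrow> coef k t = (0::'k::field)"
  using leaves_pos coef_not_wf[where 'k='k] by fastforce

text \<open>At \<open>(a, i, b)\<close> only the summand with arities \<open>leaves a\<close> and
  \<open>leaves b\<close> contributes, and its value is given by \<open>coef_graft\<close>. The
  factor \<open>graft_sign\<close> occurs twice, in the decomposition and in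
  \<open>coef_graft\<close>, and cancels.\<close>

lemma dec_cobasis:
  "dec agd_cofree (cobasis k N :: _ \<Rightarrow>\<^sub>0 'k::field) =
    (\<Sum>(n, i, m)\<in>{(n, i, m). 1 \<le> i \<and> i \<le> n \<and> 1 \<le> m \<and> n + m = N + 1}.
       smul (ksign ((int m + 1) * (int i + int n)))
         (boxtensor i (cobasis KMu n) (cobasis (if k = KD \<and> i \<noteq> 1 then KH else k) m)) +
       (if k = KMu then 0 else
       smul (ksign ((int m + 1) * (int i + int n + 1))) (boxtensor i (cobasis k n) (cobasis KMu m))))"
    (is "_ = (\<Sum>(n, i, m)\<in>?I. ?f n i m)")
proof (rule poly_mapping_eqI)
  fix z :: "agd_gen ptree \<times> nat \<times> agd_gen ptree"
  obtain a i b where z: "z = (a, i, b)" by (cases z)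
  have fin: "finite ?I"
    by (rule finite_subset[of _ "{..N+1} \<times> {..N+1} \<times> {..N+1}"]) auto
  define G :: 'k where "G =
     ksign ((int (leaves b) + 1) * (int i + int (leaves a))) * coef KMu a * coef (if k = KD \<and> i \<noteq> 1 then KH else k) b +
     (if k = KMu then 0 else ksign ((int (leaves b) + 1) * (int i + int (leaves a) + 1)) * coef k a * coef KMu b)"
  have f: "lookup (?f n j m) z = (if (n, j, m) = (leaves a, i, leaves b) then G else 0)" for n j m
    by (auto simp: z G_def lookup_add lookup_smul lookup_boxtensor lookup_cobasis)
  have "lookup (case t of (n, i, m) \<Rightarrow> ?f n i m) z = (if t = (leaves a, i, leaves b) then G else 0)" for t
    by (cases t) (simp only: f prod.case)
  then have "lookup (\<Sum>(n, i, m)\<in>?I. ?f n i m) z = (\<Sum>t\<in>?I. if t = (leaves a, i, leaves b) then G else 0)"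
    by (simp only: lookup_sum)
  also have "\<dots> = (if 1 \<le> i \<and> i \<le> leaves a \<and> 1 \<le> leaves b \<and> leaves a + leaves b = N + 1 then G else 0)"
    by (subst sum.delta[OF fin]) simp
  also have "\<dots> = lookup (dec agd_cofree (cobasis k N)) z"
  proof (cases "1 \<le> i \<and> i \<le> leaves a")
    case True
    then have i: "1 \<le> i" "i \<le> leaves a" by auto
    have l: "leaves (graft a i b) = N \<longleftrightarrow> leaves a + leaves b = N + 1"
      using leaves_graft(1)[OF i, of b] by auto
    have s: "graft_sign dg a i b * (graft_sign dg a i b * x) = (x :: 'k)" for x dg
      by (metis graft_sign_def ksign_square mult.assoc mult.left_neutral)
    show ?thesis
      using i by (auto simp: z lookup_dec_cofree lookup_cobasis l coef_graft s coef_no_leaves G_def)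
  next
    case False
    then show ?thesis unfolding z lookup_dec_cofree by auto
  qed
  finally show "lookup (dec agd_cofree (cobasis k N)) z = lookup (\<Sum>(n, i, m)\<in>?I. ?f n i m) z" by simp
qed

lemma cobasis_in_tree_part:
  "(cobasis k n :: _ \<Rightarrow>\<^sub>0 'a::field) \<in> tree_part agd_arity (\<lambda>_. 1) n (int n - 1 + int (kdeg k))"
  using coef_support[of k, where 'k='a]
  by (force simp: tree_part_def lookup_cobasis in_keys_iff tdegree_eq_weight split: if_splits)

lemma sub_cooperad_agd_span:
  "sub_cooperad (agd_cofree :: (_, 'k::field) ns_cooperad) agd_span"
proof -
  let ?T = "{boxtensor i y z | i k p m q y z. 1 \<le> i \<and> i \<le> k \<and> y \<in> agd_span k p \<and> z \<in> agd_span m q}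
     :: (agd_gen ptree \<times> nat \<times> agd_gen ptree \<Rightarrow>\<^sub>0 'k) set"
  interpret dc: Vector_Spaces.linear smul smul "dec (agd_cofree :: (_, 'k) ns_cooperad)"
    unfolding dec_def by (rule linear_lin_extend)
  have box: "boxtensor i (cobasis k n) (cobasis k' m) \<in> pm.span ?T"
    if "1 \<le> i" "i \<le> n" "1 \<le> m" for i n m k k'
  proof -
    have "1 \<le> n" using that by simp
    show ?thesis
      using that cobasis_in_agd_span[OF \<open>1 \<le> n\<close>, of k, where 'k='k]
        cobasis_in_agd_span[OF \<open>1 \<le> m\<close>, of k', where 'k='k]
      by (intro pm.span_base) blast
  qed
  have "dec agd_cofree x \<in> pm.span ?T" if "x \<in> agd_span n d" for x n d
    using that[unfolded agd_span_def]
  proof (induction rule: pm.span_induct)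
    case base
    show ?case
      by (auto simp: pm.subspace_def dc.add dc.scale dc.zero pm.span_add pm.span_scale pm.span_zero)
  next
    case (step x)
    then obtain k where x: "x = cobasis k n" by auto
    show ?case
      unfolding x dec_cobasis
      by (intro pm.span_sum) (auto intro!: pm.span_add pm.span_scale pm.span_zero box simp del: One_nat_def)
  qed
  moreover have "(agd_span n d :: (_ \<Rightarrow>\<^sub>0 'k) set) \<subseteq> tree_part agd_arity (\<lambda>_. 1) n d" for n d
    unfolding agd_span_def
    by (intro pm.span_minimal subspace_tree_part) (use cobasis_in_tree_part in blast)
  moreover have "co_part (agd_cofree :: (_, 'k) ns_cooperad) = tree_part agd_arity (\<lambda>_. 1)"
    by (simp add: cofree_cooperad_def)
  moreover have "pm.subspace (agd_span n d :: (_ \<Rightarrow>\<^sub>0 'k) set)" for n d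
    unfolding agd_span_def by (rule pm.subspace_span)
  ultimately show ?thesis
    unfolding sub_cooperad_def by (simp del: One_nat_def)
qed

section \<open>Relations and weight two\<close>

lemma tdegree_agd: "tdegree agd_degree t = 0"
proof (induction t)
  case (Node e ts)
  then show ?case by (induction ts) (auto simp: agd_degree_def)
qed simp

lemma agd_circ_eq:
  "agd_circ u i v = Poly_Mapping.single (graft (corolla agd_arity u) i (corolla agd_arity v)) (1::'k::field)"
  by (simp add: agd_circ_def free_operad_def gen_def graft_sign_def tdegree_agd ksign_def)

lemma lin_extend_single: "lin_extend (\<lambda>t. Poly_Mapping.single t 1) x = (x :: _ \<Rightarrow>\<^sub>0 'k::field)"
  by (intro poly_mapping_eqI)
     (auto simp: lookup_lin_extend lookup_single when_def if_distrib sum.delta in_keys_iff cong: if_cong)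

abbreviation agd_rel :: "(agd_gen ptree \<Rightarrow>\<^sub>0 'k::field) set" where
  "agd_rel \<equiv> qrel AsGDer"

text \<open>The generators have degree 0, so the Koszul sign in \<open>s\<^sup>2R\<close> is trivial
  and the relation space is unchanged; only the generator degrees move to 1.\<close>

lemma suspend_AsGDer:
  "suspend AsGDer = \<lparr>qarity = agd_arity, qdegree = (\<lambda>_. 1), qrel = (agd_rel :: (_ \<Rightarrow>\<^sub>0 'k::field) set)\<rparr>"
proof -
  have "root_degree agd_degree t = 0" for t
    by (cases t) (auto simp: root_degree_def agd_degree_def)
  then show ?thesis
    by (simp add: suspend_def AsGDer_def agd_degree_def ksign_def lin_extend_single)
qed

abbreviation mu_left :: "agd_gen ptree \<Rightarrow> agd_gen ptree" where
  "mu_left t \<equiv> Node GenMu [t, Leaf]"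

abbreviation mu_right :: "agd_gen ptree \<Rightarrow> agd_gen ptree" where
  "mu_right t \<equiv> Node GenMu [Leaf, t]"

abbreviation gen_h :: "agd_gen ptree" where "gen_h \<equiv> Node GenH [Leaf]"
abbreviation gen_d :: "agd_gen ptree" where "gen_d \<equiv> Node GenD [Leaf]"
abbreviation gen_mu :: "agd_gen ptree" where "gen_mu \<equiv> Node GenMu [Leaf, Leaf]"

lemma agd_rel_eq:
  "agd_rel = pm.span
    {Poly_Mapping.single (mu_left gen_mu) 1 - Poly_Mapping.single (mu_right gen_mu) (1::'k::field),
     Poly_Mapping.single (Node GenH [gen_mu]) 1 - Poly_Mapping.single (mu_left gen_h) 1
       - Poly_Mapping.single (mu_right gen_h) 1,
     Poly_Mapping.single (Node GenD [gen_mu]) 1 - Poly_Mapping.single (mu_left gen_d) 1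
       - Poly_Mapping.single (mu_right gen_h) 1}"
  by (simp add: AsGDer_def agd_circ_eq corolla_def numeral_2_eq_2)

text \<open>The weight two rewriting rules, read off the three spanning relations: the coefficients
  at the three normal forms are free and determine the others. Neither \<mu> with \<delta> in its
  second slot nor a composite of two unary generators occurs in a relation.\<close>

lemma lookup_agd_rel:
  assumes "x \<in> agd_rel"
  shows "lookup x (mu_right gen_mu) = - lookup x (mu_left gen_mu)"
    "lookup x (mu_left gen_h) = - lookup x (Node GenH [gen_mu])"
    "lookup x (mu_left gen_d) = - lookup x (Node GenD [gen_mu])"
    "lookup x (mu_right gen_h) = - (lookup x (Node GenH [gen_mu]) + lookup x (Node GenD [gen_mu]))"
    "lookup x (mu_right gen_d) = 0"
    "lookup x (Node u [Node v [Leaf]]) = 0"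
proof -
  have "lookup x (mu_right gen_mu) = - lookup x (mu_left gen_mu) \<and>
    lookup x (mu_left gen_h) = - lookup x (Node GenH [gen_mu]) \<and>
    lookup x (mu_left gen_d) = - lookup x (Node GenD [gen_mu]) \<and>
    lookup x (mu_right gen_h) = - (lookup x (Node GenH [gen_mu]) + lookup x (Node GenD [gen_mu])) \<and>
    lookup x (mu_right gen_d) = 0 \<and>
    lookup x (Node u [Node v [Leaf]]) = 0"
    using assms unfolding agd_rel_eq
  proof (induction rule: pm.span_induct)
    case base
    show ?case by (auto simp: pm.subspace_def lookup_add lookup_smul distrib_left right_diff_distrib ac_simps)
  next
    case (step x)
    then show ?case by (auto simp: lookup_minus lookup_single)
  qed
  then show "lookup x (mu_right gen_mu) = - lookup x (mu_left gen_mu)"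
    "lookup x (mu_left gen_h) = - lookup x (Node GenH [gen_mu])"
    "lookup x (mu_left gen_d) = - lookup x (Node GenD [gen_mu])"
    "lookup x (mu_right gen_h) = - (lookup x (Node GenH [gen_mu]) + lookup x (Node GenD [gen_mu]))"
    "lookup x (mu_right gen_d) = 0"
    "lookup x (Node u [Node v [Leaf]]) = 0"
    by blast+
qed

lemma weight_0: "wf_tree agd_arity t \<Longrightarrow> weight t = 0 \<longleftrightarrow> t = Leaf"
  by (cases t) auto

lemma weight_1:
  assumes "wf_tree agd_arity t" "weight t = 1"
  shows "t \<in> {gen_h, gen_d, gen_mu}"
  using assms(1)
proof (cases rule: wf_tree_cases)
  case (2 u s)
  then show ?thesis using assms weight_0[of s] by (cases u) auto
next
  case (3 s1 s2)
  then show ?thesis using assms weight_0[of s1] weight_0[of s2] by auto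
qed (use assms in auto)

lemma weight_2:
  assumes "wf_tree agd_arity t" "weight t = 2"
  obtains u s where "u \<noteq> GenMu" "t = Node u [s]" "s \<in> {gen_h, gen_d, gen_mu}"
  | s where "t = mu_left s" "s \<in> {gen_h, gen_d, gen_mu}"
  | s where "t = mu_right s" "s \<in> {gen_h, gen_d, gen_mu}"
  using assms(1)
proof (cases rule: wf_tree_cases)
  case (2 u s)
  then show ?thesis using assms weight_1[of s] that by auto
next
  case (3 s1 s2)
  then have "weight s1 + weight s2 = 1" using assms by simp
  then consider "weight s1 = 0" "weight s2 = 1" | "weight s1 = 1" "weight s2 = 0" by linarith
  then show ?thesis
    using 3 weight_0[of s1] weight_0[of s2] weight_1[of s1] weight_1[of s2] that by cases auto
qed (use assms in auto)

text \<open>In weight two the candidates are the defining relations up to the common sign -1. This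
  is where the recursion for \<open>coef\<close> meets the presentation of the operad.\<close>

lemma cobasis_weight_2:
  "cobasis KMu 3 = smul (-1) (Poly_Mapping.single (mu_left gen_mu) 1 - Poly_Mapping.single (mu_right gen_mu) (1::'k::field))"
  "cobasis KH 2 = smul (-1) (Poly_Mapping.single (Node GenH [gen_mu]) 1 - Poly_Mapping.single (mu_left gen_h) 1
       - Poly_Mapping.single (mu_right gen_h) (1::'k))"
  "cobasis KD 2 = smul (-1) (Poly_Mapping.single (Node GenD [gen_mu]) 1 - Poly_Mapping.single (mu_left gen_d) 1
       - Poly_Mapping.single (mu_right gen_h) (1::'k))"
proof -
  have *: "cobasis k n = x" if "weight (canon k n) = 2" "1 \<le> n"
    "\<And>t. \<not> (wf_tree agd_arity t \<and> weight t = 2) \<Longrightarrow> lookup x t = 0"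
    "\<And>u s. u \<noteq> GenMu \<Longrightarrow> s \<in> {gen_h, gen_d, gen_mu} \<Longrightarrow> lookup (cobasis k n) (Node u [s]) = lookup x (Node u [s])"
    "\<And>s. s \<in> {gen_h, gen_d, gen_mu} \<Longrightarrow> lookup (cobasis k n) (mu_left s) = lookup x (mu_left s)"
    "\<And>s. s \<in> {gen_h, gen_d, gen_mu} \<Longrightarrow> lookup (cobasis k n) (mu_right s) = lookup x (mu_right s)"
    for k n and x :: "_ \<Rightarrow>\<^sub>0 'k"
  proof (rule poly_mapping_eqI)
    fix t
    show "lookup (cobasis k n) t = lookup x t"
    proof (cases "wf_tree agd_arity t \<and> weight t = 2")
      case True
      then have "wf_tree agd_arity t" "weight t = 2" by auto
      then show ?thesis by (cases rule: weight_2) (use that in auto)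
    next
      case False
      with that(1,2,3) weight_canon[OF that(2), of k] show ?thesis
        by (cases "wf_tree agd_arity t") (auto simp: lookup_cobasis coef_not_wf intro!: coef_eq_0)
    qed
  qed
  have u: "u \<noteq> GenMu \<Longrightarrow> u = GenH \<or> u = GenD" for u by (cases u) auto
  show "cobasis KMu 3 = smul (-1) (Poly_Mapping.single (mu_left gen_mu) 1 - Poly_Mapping.single (mu_right gen_mu) (1::'k::field))"
    by (rule *) (auto simp: lookup_cobasis lookup_smul lookup_minus lookup_single when_def ksign_def dest!: u)
  show "cobasis KH 2 = smul (-1) (Poly_Mapping.single (Node GenH [gen_mu]) 1 - Poly_Mapping.single (mu_left gen_h) 1
       - Poly_Mapping.single (mu_right gen_h) (1::'k))"
    by (rule *) (auto simp: lookup_cobasis lookup_smul lookup_minus lookup_single when_def ksign_def dest!: u)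
  show "cobasis KD 2 = smul (-1) (Poly_Mapping.single (Node GenD [gen_mu]) 1 - Poly_Mapping.single (mu_left gen_d) 1
       - Poly_Mapping.single (mu_right gen_h) (1::'k))"
    by (rule *) (auto simp: lookup_cobasis lookup_smul lookup_minus lookup_single when_def ksign_def dest!: u)
qed

lemma subspace_agd_rel: "pm.subspace (agd_rel :: (_ \<Rightarrow>\<^sub>0 'k::field) set)"
  unfolding agd_rel_eq by (rule pm.subspace_span)

text \<open>\<open>cobasis k n\<close> is homogeneous of weight \<open>n - 1 + kdeg k\<close>, so
  its weight two part is either everything, when \<open>n + kdeg k = 3\<close>, or zero.\<close>

lemma weight_part_cobasis:
  assumes "1 \<le> n"
  shows "weight_part 2 (cobasis k n) \<in> (agd_rel :: (_ \<Rightarrow>\<^sub>0 'k::field) set)"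
proof (cases "n + kdeg k = 3")
  case True
  then consider "k = KMu" "n = 3" | "k = KH" "n = 2" | "k = KD" "n = 2"
    by (cases k) (auto simp: kdeg_def)
  then have "cobasis k n \<in> (agd_rel :: (_ \<Rightarrow>\<^sub>0 'k::field) set)"
    unfolding agd_rel_eq
    by cases (simp only: cobasis_weight_2, intro pm.span_scale pm.span_base, blast)+
  moreover have "weight_part 2 (cobasis k n) = (cobasis k n :: _ \<Rightarrow>\<^sub>0 'k)"
    using True coef_support[of k, where 'k='k]
    by (intro poly_mapping_eqI) (fastforce simp: lookup_weight_part lookup_cobasis)
  ultimately show ?thesis by simp
next
  case False
  have "weight_part 2 (cobasis k n) = (0 :: _ \<Rightarrow>\<^sub>0 'k)"
    using False coef_support[of k, where 'k='k]
    by (intro poly_mapping_eqI) (fastforce simp: lookup_weight_part lookup_cobasis)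
  then show ?thesis using subspace_agd_rel[where 'k='k] by (simp add: pm.subspace_0)
qed

lemma weight_part_agd_span:
  assumes "x \<in> agd_span n d"
  shows "weight_part 2 x \<in> (agd_rel :: (_ \<Rightarrow>\<^sub>0 'k::field) set)"
proof -
  interpret wp: Vector_Spaces.linear smul smul "weight_part 2 :: (agd_gen ptree \<Rightarrow>\<^sub>0 'k) \<Rightarrow> _"
    by (rule linear_weight_part)
  show ?thesis
    using assms unfolding agd_span_def
  proof (induction rule: pm.span_induct)
    case base
    show ?case
      using subspace_agd_rel[where 'k='k] by (auto simp: pm.subspace_def wp.add wp.scale wp.zero)
  qed (auto intro: weight_part_cobasis simp del: One_nat_def)
qed

abbreviation agd_dual :: "nat \<Rightarrow> int \<Rightarrow> (agd_gen ptree \<Rightarrow>\<^sub>0 'k::field) set" where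
  "agd_dual \<equiv> co_part (koszul_dual_cooperad AsGDer)"

lemma agd_dual_greatest:
  shows sub_cooperad_agd_dual: "sub_cooperad (agd_cofree :: (_, 'k::field) ns_cooperad) agd_dual"
    and weight_part_agd_dual: "x \<in> agd_dual n d \<Longrightarrow> weight_part 2 x \<in> (agd_rel :: (_ \<Rightarrow>\<^sub>0 'k) set)"
    and agd_span_subset: "agd_span n d \<subseteq> (agd_dual n d :: (_ \<Rightarrow>\<^sub>0 'k) set)"
  using quadratic_cooperad_greatest[of "suspend AsGDer :: (_, 'k) quadratic_data"]
    subspace_agd_rel[where 'k='k] sub_cooperad_agd_span[where 'k='k] weight_part_agd_span[where 'k='k]
  by (simp_all add: koszul_dual_cooperad_def suspend_AsGDer)

section \<open>Determination of the Koszul dual cooperad\<close>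

lemma agd_dual_support:
  assumes "x \<in> (agd_dual n d :: (_ \<Rightarrow>\<^sub>0 'k::field) set)" "lookup x t \<noteq> 0"
  shows "wf_tree agd_arity t" "leaves t = n" "int (weight t) = d"
proof -
  have "x \<in> tree_part agd_arity (\<lambda>_. 1) n d"
    using sub_cooperad_agd_dual[where 'k='k] assms(1) by (auto simp: sub_cooperad_def cofree_cooperad_def)
  with assms(2) show "wf_tree agd_arity t" "leaves t = n" "int (weight t) = d"
    by (auto simp: tree_part_def in_keys_iff tdegree_eq_weight)
qed

section \<open>Reduction to normal forms\<close>

definition canon_coef :: "kind \<Rightarrow> (agd_gen ptree \<Rightarrow>\<^sub>0 'k::field) \<Rightarrow> nat \<Rightarrow> 'k" where
  "canon_coef k x n = lookup x (canon k n) / coef k (canon k n)"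

text \<open>The upper bound in weight \<open>w\<close>, stated coefficientwise: \<open>x\<close> is
  the combination of the \<open>cobasis\<close> elements with coordinates \<open>canon_coef\<close>.
  The type argument fixes the field, and isolating \<open>w\<close> prepares the induction on
  weight.\<close>

definition determined :: "'k::field itself \<Rightarrow> nat \<Rightarrow> bool" where
  "determined _ w \<longleftrightarrow> (\<forall>n. \<forall>x\<in>(agd_dual n (int w) :: (_ \<Rightarrow>\<^sub>0 'k) set). \<forall>t.
     lookup x t = (\<Sum>k\<in>UNIV. coef k t * canon_coef k x (leaves t)))"

text \<open>If the degree of \<open>y\<close> differs from the weight of \<open>a\<close>, both
  sides vanish, because a normal form with \<open>coef k a \<noteq> 0\<close> has the same weight as
  \<open>a\<close>. Tensor factors of unknown degree can thus be treated uniformly.\<close>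

lemma determined_lookup:
  assumes "determined TYPE('k::field) (weight a)" "y \<in> (agd_dual n d :: (_ \<Rightarrow>\<^sub>0 'k) set)"
  shows "lookup y a = (\<Sum>k\<in>UNIV. coef k a * canon_coef k y (leaves a))"
proof (cases "d = int (weight a)")
  case True
  then show ?thesis using assms unfolding determined_def by blast
next
  case False
  have "coef k a * canon_coef k y (leaves a) = 0" for k
  proof (rule ccontr)
    assume "coef k a * canon_coef k y (leaves a) \<noteq> 0"
    then have nz: "coef k a \<noteq> (0::'k)" "lookup y (canon k (leaves a)) \<noteq> 0"
      by (auto simp: canon_coef_def)
    from coef_support[OF nz(1)] have "weight a + 1 = leaves a + kdeg k" "1 \<le> leaves a"
      using leaves_pos by auto
    with weight_canon[of "leaves a" k] have "weight (canon k (leaves a)) = weight a" by simp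
    with agd_dual_support(3)[OF assms(2) nz(2)] False show False by simp
  qed
  moreover have "lookup y a = 0"
    using agd_dual_support(3)[OF assms(2)] False by auto
  ultimately show ?thesis by (simp del: mult_eq_0_iff)
qed

text \<open>
  Coefficients of \<open>x\<close> at a grafting are coefficients of its decomposition, so that by the sub-cooperad
  property both grafted trees can be replaced by their normal forms.
\<close>

lemma lookup_graft_eq_0:
  assumes x: "x \<in> (agd_dual n d :: (_ \<Rightarrow>\<^sub>0 'k::field) set)"
    and det: "determined TYPE('k) (weight a)" "determined TYPE('k) (weight b)"
    and i: "1 \<le> i" "i \<le> leaves a"
    and 0: "\<And>k k'. coef k a \<noteq> (0::'k) \<Longrightarrow> coef k' b \<noteq> (0::'k) \<Longrightarrow>
      lookup x (graft (canon k (leaves a)) i (canon k' (leaves b))) = 0"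
  shows "lookup x (graft a i b) = 0"
proof -
  let ?T = "{boxtensor i y z | i k p m q y z. 1 \<le> i \<and> i \<le> k \<and> y \<in> agd_dual k p \<and> z \<in> agd_dual m q}
     :: (agd_gen ptree \<times> nat \<times> agd_gen ptree \<Rightarrow>\<^sub>0 'k) set"
  let ?c = "\<lambda>k t. coef k t / coef k (canon k (leaves t)) :: 'k"
  have "dec agd_cofree x \<in> pm.span ?T"
    using sub_cooperad_agd_dual[where 'k='k] x by (auto simp: sub_cooperad_def simp del: One_nat_def)
  \<comment> \<open>The identity is linear in the decomposition, so it suffices to check it on pure
    tensors, where it is a product of two instances of \<open>determined_lookup\<close>.\<close>
  then have "lookup (dec agd_cofree x) (a, i, b) = (\<Sum>k\<in>UNIV. \<Sum>k'\<in>UNIV. ?c k a * ?c k' b *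
      lookup (dec agd_cofree x) (canon k (leaves a), i, canon k' (leaves b)))"
  proof (induction rule: pm.span_induct)
    case base
    show ?case
      by (auto simp: pm.subspace_def lookup_add lookup_smul sum.distrib distrib_left sum_distrib_left
        mult.assoc mult.left_commute add_divide_distrib)
  next
    case (step w)
    then obtain j k p m q y z where w: "w = boxtensor j y z" "y \<in> agd_dual k p" "z \<in> agd_dual m q"
      by blast
    show ?case
      unfolding w(1) lookup_boxtensor determined_lookup[OF det(1) w(2)] determined_lookup[OF det(2) w(3)]
      by (auto simp: sum_product canon_coef_def mult_ac intro!: sum.cong)
  qed
  also have "\<dots> = 0"
  proof (intro sum.neutral ballI)
    fix k k'
    show "?c k a * ?c k' b * lookup (dec agd_cofree x) (canon k (leaves a), i, canon k' (leaves b)) = 0"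
      using 0[of k k'] by (auto simp: lookup_dec_cofree)
  qed
  finally show ?thesis
    using i by (simp add: lookup_dec_cofree graft_sign_def ksign_nonzero)
qed

lemma unary_cases: "u \<noteq> GenMu \<Longrightarrow> u = GenH \<or> u = GenD"
  by (cases u) auto

lemma canon_cases:
  obtains "k = KMu" "canon k n = left_comb (n - 1)"
  | u where "k \<noteq> KMu" "u \<noteq> GenMu" "canon k n = Node u [left_comb (n - 1)]"
  using that by (cases k) auto

lemma agd_dual_eq_0:
  assumes x: "x \<in> (agd_dual n (int w) :: (_ \<Rightarrow>\<^sub>0 'k::field) set)"
    and det: "\<And>v. v < w \<Longrightarrow> determined TYPE('k) v"
    and 0: "\<And>k. lookup x (canon k n) = 0"
  shows "lookup x t = 0"
proof -
  define Z where "Z t \<longleftrightarrow> lookup x t = 0" for t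
  \<comment> \<open>An element of the dual is supported on well-formed trees of its own arity and
    weight, so vanishing need only be shown there.\<close>
  have wf: "Z t" if "wf_tree agd_arity t \<Longrightarrow> leaves t = n \<Longrightarrow> weight t = w \<Longrightarrow> Z t" for t
    using agd_dual_support[OF x, of t] that unfolding Z_def by auto
  \<comment> \<open>Both parts have positive weight, hence weight below \<open>w\<close>, so
    \<open>det\<close> applies to each. Weight two itself is left to the relations.\<close>
  have red: "Z (graft a i b)" if "1 \<le> i" "i \<le> leaves a" "1 \<le> weight a" "1 \<le> weight b"
    "\<And>k k'. coef k a \<noteq> (0::'k) \<Longrightarrow> coef k' b \<noteq> (0::'k) \<Longrightarrow>
      Z (graft (canon k (leaves a)) i (canon k' (leaves b)))" for a i b
  proof (rule wf)
    assume "weight (graft a i b) = w"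
    with that weight_graft(1)[of i a b] have "weight a < w" "weight b < w" by auto
    show "Z (graft a i b)"
      unfolding Z_def by (rule lookup_graft_eq_0[OF x]) (use that det \<open>weight a < w\<close> \<open>weight b < w\<close> in \<open>auto simp: Z_def\<close>)
  qed
  have Zcanon: "Z (canon k m)" if "1 \<le> m" for k m
    by (rule wf) (use that leaves_canon[OF that, of k] 0[of k] in \<open>auto simp: Z_def\<close>)
  have Zcomb: "Z (left_comb j)" "u \<noteq> GenMu \<Longrightarrow> Z (Node u [left_comb j])" for u j
    using Zcanon[of "Suc j" KMu] Zcanon[of "Suc j" KH] Zcanon[of "Suc j" KD] unary_cases[of u] by auto
  have Zrel: "Z t" if "weight t = 2" "lookup (weight_part 2 x) t = 0" for t
    using that by (simp add: Z_def lookup_weight_part)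
  note rel = lookup_agd_rel[OF weight_part_agd_dual[OF x]]
  have w2: "lookup (weight_part 2 x) t = 0" if "Z t" for t
    using that by (simp add: Z_def lookup_weight_part)
  have gen_mu_0: "lookup (weight_part 2 x) (Node GenH [gen_mu]) = 0"
      "lookup (weight_part 2 x) (Node GenD [gen_mu]) = 0"
      "lookup (weight_part 2 x) (mu_left gen_mu) = 0"
    by (rule w2; use Zcomb(2)[of GenH 1] Zcomb(2)[of GenD 1] Zcomb(1)[of "Suc 1"] in simp)+
  have Zmu2: "Z (mu_right gen_mu)"
    by (rule Zrel) (auto simp: rel gen_mu_0)
  have Zmu_unary: "Z (mu_left (Node u [Leaf]))" "Z (mu_right (Node u [Leaf]))" if "u \<noteq> GenMu" for u
    using unary_cases[OF that] by (auto intro!: Zrel simp: rel gen_mu_0)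
  have Zuu: "Z (Node u [Node v [left_comb j]])" if "u \<noteq> GenMu" "v \<noteq> GenMu" for u v j
  proof (cases j)
    case 0
    then show ?thesis by (auto intro!: Zrel simp: rel)
  next
    case (Suc j')
    have z: "coef k (Node u [Node v [Leaf]]) = (0::'k)" for k
      using unary_cases[OF that(1)] unary_cases[OF that(2)] by auto
    \<comment> \<open>All three coefficients of the lower tree vanish, so the condition of
      \<open>red\<close> on normal forms is vacuous.\<close>
    have "Z (graft (Node u [Node v [Leaf]]) 1 (left_comb j))"
      by (rule red) (use Suc z in auto)
    then show ?thesis by simp
  qed
  have Zu: "Z (Node u [s])" if u: "u \<noteq> GenMu" for u s
  proof (rule wf)
    assume s: "wf_tree agd_arity (Node u [s])"
    show "Z (Node u [s])"
    proof (cases "weight s = 0")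
      case True
      with s show ?thesis using weight_0[of s] Zcomb(2)[OF u, of 0] by auto
    next
      case False
      have "Z (graft (Node u [Leaf]) 1 s)"
      proof (rule red)
        fix k k'
        assume "coef k (Node u [Leaf]) \<noteq> (0::'k)" "coef k' s \<noteq> (0::'k)"
        then have k: "canon k 1 = Node u [Leaf]" and l: "1 \<le> leaves s"
          using unary_cases[OF u] leaves_pos coef_support[of k' s, where 'k='k] by (auto split: if_splits)
        show "Z (graft (canon k (leaves (Node u [Leaf]))) 1 (canon k' (leaves s)))"
          by (cases rule: canon_cases[of k' "leaves s"]) (use k Zcomb(2)[OF u] Zuu[OF u] in auto)
      qed (use False in auto)
      then show ?thesis by simp
    qed
  qed
  \<comment> \<open>A unary normal form has a unary root, which grafting preserves. From here on,
    parts whose \<open>KMu\<close> coefficient vanishes need no further analysis.\<close>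
  have Zcanon_unary: "Z (graft (canon k l) i b)" if "k \<noteq> KMu" for k l i b
    using that by (cases k) (auto simp: Zu)
  have Zmu_left_unary: "Z (mu_left (Node u [left_comb j]))" if u: "u \<noteq> GenMu" for u j
  proof (cases j)
    case 0
    then show ?thesis using Zmu_unary[OF u] by simp
  next
    case (Suc j')
    have z: "coef KMu (mu_left (Node u [Leaf])) = (0::'k)"
      using unary_cases[OF u] by auto
    have "Z (graft (mu_left (Node u [Leaf])) 1 (left_comb j))"
      by (rule red) (use Suc z in \<open>auto intro!: Zcanon_unary\<close>)
    then show ?thesis by simp
  qed
  have Zmu_left: "Z (mu_left s)" for s
  proof (rule wf)
    assume s: "wf_tree agd_arity (mu_left s)"
    show "Z (mu_left s)"
    proof (cases "weight s = 0")
      case True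
      with s show ?thesis using weight_0[of s] Zcomb(1)[of 1] by auto
    next
      case False
      have "Z (graft gen_mu 1 s)"
      proof (rule red)
        fix k k'
        assume "coef k gen_mu \<noteq> (0::'k)" "coef k' s \<noteq> (0::'k)"
        then have k: "k = KMu" and l: "1 \<le> leaves s"
          using leaves_pos coef_support[of k' s, where 'k='k] by (auto split: if_splits)
        show "Z (graft (canon k (leaves gen_mu)) 1 (canon k' (leaves s)))"
          by (cases rule: canon_cases[of k' "leaves s"])
            (use k Zcomb(1)[of "Suc (leaves s - 1)"] Zmu_left_unary in auto)
      qed (use False in auto)
      then show ?thesis by simp
    qed
  qed
  have Zmu_right: "Z (mu_right (mu_left (left_comb j)))" for j
  proof (cases j)
    case 0
    then show ?thesis using Zmu2 by simp
  next
    case (Suc j')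
    \<comment> \<open>The lower tree rewrites to the comb with three leaves. Its second leaf lies in
      the left branch, so the result has the shape \<open>mu_left\<close>, already settled.\<close>
    have "Z (graft (mu_right gen_mu) 2 (left_comb j))"
    proof (rule red)
      fix k k'
      assume "coef k (mu_right gen_mu) \<noteq> (0::'k)"
      then have k: "k = KMu" by (auto split: if_splits)
      show "Z (graft (canon k (leaves (mu_right gen_mu))) 2 (canon k' (leaves (left_comb j))))"
        by (simp add: k Zmu_left numeral_2_eq_2)
    qed (use Suc in auto)
    then show ?thesis by (simp add: numeral_2_eq_2)
  qed
  have Zmu_left_comb: "Z (Node GenMu [left_comb i, mu_left (left_comb j)])" for i j
  proof (cases i)
    case 0
    then show ?thesis using Zmu_right by simp
  next
    case (Suc i')
    have "Z (graft (mu_right (mu_left (left_comb j))) 1 (left_comb i))"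
    proof (rule red)
      fix k k'
      assume "coef k (mu_right (mu_left (left_comb j))) \<noteq> (0::'k)"
      then have k: "k = KMu"
        using coef_support[of k "mu_right (mu_left (left_comb j))", where 'k='k] by (auto simp: kdeg_def split: if_splits)
      show "Z (graft (canon k (leaves (mu_right (mu_left (left_comb j))))) 1 (canon k' (leaves (left_comb i))))"
        by (simp add: k Zmu_left)
    qed (use Suc in auto)
    then show ?thesis by simp
  qed
  have Zmu_left_comb_unary: "Z (Node GenMu [left_comb i, Node u [left_comb j]])" if u: "u \<noteq> GenMu" for i j u
  proof (cases j)
    case (Suc j')
    have z: "coef KMu (Node GenMu [left_comb i, Node u [Leaf]]) = (0::'k)"
      using unary_cases[OF u] by auto
    have "Z (graft (Node GenMu [left_comb i, Node u [Leaf]]) (i + 2) (left_comb j))"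
      by (rule red) (use Suc z in \<open>auto intro!: Zcanon_unary\<close>)
    then show ?thesis by simp
  next
    case j: 0
    show ?thesis
    proof (cases i)
      case 0
      then show ?thesis using j Zmu_unary[OF u] by simp
    next
      case (Suc i')
      have z: "coef KMu (mu_right (Node u [Leaf])) = (0::'k)"
        using unary_cases[OF u] by auto
      have "Z (graft (mu_right (Node u [Leaf])) 1 (left_comb i))"
        by (rule red) (use Suc z in \<open>auto intro!: Zcanon_unary\<close>)
      then show ?thesis using j by simp
    qed
  qed
  have Zmu: "Z (Node GenMu [s1, s2])" if s: "wf_tree agd_arity s1" "wf_tree agd_arity s2" for s1 s2
  proof (cases "weight s2 = 0")
    case True
    then show ?thesis using s(2) weight_0[of s2] Zmu_left by auto
  next
    case False
    have l: "1 \<le> leaves s1" "1 \<le> leaves s2" using s leaves_pos by auto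
    \<comment> \<open>The last leaf of \<open>mu_left s1\<close> is its right branch, so the whole
      tree is recovered; normalising the two parts turns \<open>s1\<close> into a comb and
      \<open>s2\<close> into a normal form.\<close>
    have "Z (graft (mu_left s1) (leaves s1 + 1) s2)"
    proof (rule red)
      fix k k'
      show "Z (graft (canon k (leaves (mu_left s1))) (leaves s1 + 1) (canon k' (leaves s2)))"
      proof (cases "k = KMu")
        case True
        obtain i where i: "leaves s1 = Suc i" using l by (cases "leaves s1") auto
        have "Z (Node GenMu [left_comb i, canon k' (leaves s2)])"
        proof (cases rule: canon_cases[of k' "leaves s2"])
          case 1
          then show ?thesis by (cases "leaves s2 - 1") (auto simp: Zmu_left Zmu_left_comb)
        next
          case (2 u)
          then show ?thesis by (simp add: Zmu_left_comb_unary)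
        qed
        then show ?thesis using True i by simp
      qed (rule Zcanon_unary)
    qed (use False in auto)
    then show ?thesis by simp
  qed
  have "Z t"
  proof (rule wf)
    assume "wf_tree agd_arity t"
    then show "Z t"
      by (cases rule: wf_tree_cases) (use Zcomb(1)[of 0] Zu Zmu in auto)
  qed
  then show ?thesis by (simp add: Z_def)
qed

text \<open>Subtracting from \<open>x\<close> the combination of \<open>cobasis\<close> elements
  with the same normal form coefficients leaves an element killed by \<open>agd_dual_eq_0\<close>.
  That lemma needs all smaller weights, hence strong induction.\<close>

lemma determined: "determined TYPE('k::field) w"
proof (induction w rule: less_induct)
  case (less w)
  show ?case
    unfolding determined_def
  proof (intro allI ballI)
    fix n t and x :: "agd_gen ptree \<Rightarrow>\<^sub>0 'k"
    assume x: "x \<in> agd_dual n (int w)"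
    show "lookup x t = (\<Sum>k\<in>UNIV. coef k t * canon_coef k x (leaves t))"
    proof (cases "leaves t = n \<and> 1 \<le> n")
      case False
      then have "lookup x t = 0"
        using agd_dual_support[OF x, of t] leaves_pos[of t] by auto
      moreover have "coef k t * canon_coef k x (leaves t) = 0" for k
        using False agd_dual_support(2)[OF x, of "canon k (leaves t)"] leaves_canon[of "leaves t" k]
          coef_no_leaves[of t k, where 'k='k]
        by (cases "leaves t = 0") (auto simp: canon_coef_def)
      ultimately show ?thesis by (simp del: mult_eq_0_iff)
    next
      case True
      then have n: "1 \<le> n" by simp
      let ?s = "\<Sum>k\<in>UNIV. smul (canon_coef k x n) (cobasis k n)"
      have sub: "pm.subspace (agd_dual n (int w) :: (_ \<Rightarrow>\<^sub>0 'k) set)"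
        using sub_cooperad_agd_dual[where 'k='k] by (simp add: sub_cooperad_def)
      have "smul (canon_coef k x n) (cobasis k n) \<in> agd_dual n (int w)" for k
      proof (cases "lookup x (canon k n) = 0")
        case True
        then show ?thesis using sub by (simp add: canon_coef_def pm.subspace_0)
      next
        case False
        \<comment> \<open>A nonzero coordinate forces the degree of \<open>cobasis k n\<close> to be
          \<open>w\<close>, so the summand stays in the same homogeneous component.\<close>
        have "int (weight (canon k n)) = int n - 1 + int (kdeg k)"
          using weight_canon[OF n, of k] by linarith
        then have "int w = int n - 1 + int (kdeg k)"
          using agd_dual_support(3)[OF x False] by simp
        then have "cobasis k n \<in> (agd_dual n (int w) :: (_ \<Rightarrow>\<^sub>0 'k) set)"
          using cobasis_in_agd_span[OF n, of k, where 'k='k] agd_span_subset[of n "int w", where 'k='k] by auto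
        then show ?thesis using sub by (simp add: pm.subspace_scale)
      qed
      then have "x - ?s \<in> agd_dual n (int w)"
        by (intro pm.subspace_diff[OF sub x] pm.subspace_sum[OF sub]) auto
      then have "lookup (x - ?s) t = 0"
      proof (rule agd_dual_eq_0)
        fix k
        have "lookup ?s (canon k n) = (\<Sum>j\<in>UNIV. if j = k then lookup x (canon k n) else 0)"
          unfolding lookup_sum
          by (intro sum.cong refl)
            (auto simp: lookup_smul lookup_cobasis leaves_canon[OF n] canon_coef_def coef_canon_eq_0_iff)
        then show "lookup (x - ?s) (canon k n) = 0"
          by (simp add: lookup_minus)
      qed (rule less)
      then show ?thesis
        using True by (simp add: lookup_minus lookup_sum lookup_smul lookup_cobasis mult.commute[of "canon_coef _ _ _"])
    qed
  qed
qed

lemma agd_dual_eq: "agd_dual n d = (agd_span n d :: (_ \<Rightarrow>\<^sub>0 'k::field) set)"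
proof
  show "agd_dual n d \<subseteq> (agd_span n d :: (_ \<Rightarrow>\<^sub>0 'k) set)"
  proof
    fix x :: "agd_gen ptree \<Rightarrow>\<^sub>0 'k"
    assume x: "x \<in> agd_dual n d"
    have eq: "x = (\<Sum>k\<in>UNIV. smul (canon_coef k x n) (cobasis k n))"
    proof (rule poly_mapping_eqI)
      fix t
      show "lookup x t = lookup (\<Sum>k\<in>UNIV. smul (canon_coef k x n) (cobasis k n)) t"
        using determined_lookup[OF determined x, of t] agd_dual_support(2)[OF x, of t]
        by (cases "leaves t = n") (auto simp: lookup_sum lookup_smul lookup_cobasis mult.commute)
    qed
    have "smul (canon_coef k x n) (cobasis k n) \<in> agd_span n d" for k
    proof (cases "1 \<le> n \<and> lookup x (canon k n) \<noteq> 0")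
      case False
      then have "lookup x (canon k n) = 0"
        using agd_dual_support(1,2)[OF x, of "canon k n"] leaves_pos[of "canon k n"] by (metis)
      then show ?thesis by (simp add: canon_coef_def agd_span_def pm.span_zero)
    next
      case True
      then have n: "1 \<le> n" by simp
      have "int (weight (canon k n)) = int n - 1 + int (kdeg k)"
        using weight_canon[OF n, of k] by linarith
      then have "d = int n - 1 + int (kdeg k)"
        using agd_dual_support(3)[OF x, of "canon k n"] True by simp
      then have "cobasis k n \<in> (agd_span n d :: (_ \<Rightarrow>\<^sub>0 'k) set)"
        using cobasis_in_agd_span[OF n, of k, where 'k='k] by simp
      then show ?thesis unfolding agd_span_def by (rule pm.span_scale)
    qed
    then have "(\<Sum>k\<in>UNIV. smul (canon_coef k x n) (cobasis k n)) \<in> agd_span n d"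
      unfolding agd_span_def by (intro pm.span_sum)
    then show "x \<in> agd_span n d" using eq by simp
  qed
qed (rule agd_span_subset)

section \<open>The Koszul dual operad\<close>

text \<open>The triple \<open>(n, i, m)\<close> arises from the single index
  \<open>p = i - 1\<close>, \<open>q = m\<close>, \<open>r = n - i\<close>.\<close>

lemma lookup_bdec_suspension:
  "lookup (bdec suspension_cooperad N) (n, i, m) =
    (if 1 \<le> i \<and> i \<le> n \<and> 1 \<le> m \<and> n + m = N + 1
     then ksign ((int i - 1) * (int m - 1)) else (0::'k::field))"
proof -
  let ?I = "{(p, q, r). 1 \<le> q \<and> p + q + r = N}"
  let ?c = "1 \<le> i \<and> i \<le> n \<and> 1 \<le> m \<and> n + m = N + 1"
  have fin: "finite ?I"
    by (rule finite_subset[of _ "{..N} \<times> {..N} \<times> {..N}"]) auto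
  have "lookup (case t of (p, q, r) \<Rightarrow> Poly_Mapping.single (p + r + 1, p + 1, q) (ksign (int p * (int q - 1)))) (n, i, m) =
     (if t = (i - 1, m, n - i) then if ?c then ksign ((int i - 1) * (int m - 1)) else (0::'k) else 0)"
    if "t \<in> ?I" for t
    using that by (cases t) (auto simp: lookup_single when_def of_nat_diff)
  then have "lookup (bdec suspension_cooperad N) (n, i, m) =
     (\<Sum>t\<in>?I. if t = (i - 1, m, n - i) then if ?c then ksign ((int i - 1) * (int m - 1)) else (0::'k) else 0)"
    unfolding suspension_cooperad_def by (simp add: lookup_sum)
  also have "\<dots> = (if (i - 1, m, n - i) \<in> ?I then if ?c then ksign ((int i - 1) * (int m - 1)) else 0 else 0)"
    by (rule sum.delta[OF fin])
  also have "\<dots> = (if ?c then ksign ((int i - 1) * (int m - 1)) else 0)"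
    by auto
  finally show ?thesis .
qed

lemma lookup_bdec_hadamard:
  "lookup (bdec (hadamard C D) (a, b)) ((a1, b1), i, (a2, b2)) =
    (if barity C a1 = barity D b1 \<and> barity C a2 = barity D b2
     then ksign (bdegree C a2 * bdegree D b1) * lookup (bdec C a) (a1, i, a2) * lookup (bdec D b) (b1, i, b2)
     else (0::'k::field))"
proof -
  let ?S = "{((a1, i, a2), (b1, j, b2)).
             (a1, i, a2) \<in> keys (bdec C a) \<and> (b1, j, b2) \<in> keys (bdec D b) \<and>
             i = j \<and> barity C a1 = barity D b1 \<and> barity C a2 = barity D b2}"
  let ?v = "ksign (bdegree C a2 * bdegree D b1) * lookup (bdec C a) (a1, i, a2) * lookup (bdec D b) (b1, i, b2)"
  have fin: "finite ?S"
    by (rule finite_subset[of _ "keys (bdec C a) \<times> keys (bdec D b)"]) auto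
  have "lookup (bdec (hadamard C D) (a, b)) ((a1, b1), i, (a2, b2)) =
     (\<Sum>z\<in>?S. if z = ((a1, i, a2), (b1, i, b2)) then ?v else 0)"
    unfolding hadamard_def
    by (auto simp: lookup_sum lookup_single when_def split_beta intro!: sum.cong)
  also have "\<dots> = (if ((a1, i, a2), (b1, i, b2)) \<in> ?S then ?v else 0)"
    by (rule sum.delta[OF fin])
  finally show ?thesis by (auto simp: in_keys_iff)
qed

lemma lookup_dec_at:
  "lookup (dec_at C n i m x) (a, j, b) =
    (if barity C a = n \<and> j = i \<and> barity C b = m then lookup (dec C x) (a, j, b) else (0::'k::field))"
proof -
  let ?S = "{(a, j, b). (a, j, b) \<in> keys (dec C x) \<and> barity C a = n \<and> j = i \<and> barity C b = m}"
  have fin: "finite ?S"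
    by (rule finite_subset[of _ "keys (dec C x)"]) auto
  have "lookup (dec_at C n i m x) (a, j, b) =
     (\<Sum>z\<in>?S. if z = (a, j, b) then lookup (dec C x) (a, j, b) else 0)"
    unfolding dec_at_def
    by (auto simp: lookup_sum lookup_single when_def split_beta intro!: sum.cong)
  also have "\<dots> = (if (a, j, b) \<in> ?S then lookup (dec C x) (a, j, b) else 0)"
    by (rule sum.delta[OF fin])
  finally show ?thesis by (auto simp: in_keys_iff)
qed

section \<open>The Hadamard product with the suspension cooperad\<close>

abbreviation agd_hadamard :: "(nat \<times> agd_gen ptree, 'k::field) ns_cooperad" where
  "agd_hadamard \<equiv> hadamard suspension_cooperad (koszul_dual_cooperad AsGDer)"

lemma agd_dual_sel:
  "barity (koszul_dual_cooperad AsGDer :: (_, 'k::field) ns_cooperad) = leaves"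
  "bdegree (koszul_dual_cooperad AsGDer :: (_, 'k) ns_cooperad) = tdegree (\<lambda>_. 1)"
  "bdec (koszul_dual_cooperad AsGDer :: (_, 'k) ns_cooperad) = bdec agd_cofree"
  "bcounit (koszul_dual_cooperad AsGDer :: (_, 'k) ns_cooperad) t = (if t = Leaf then 1 else 0)"
  by (simp_all add: koszul_dual_cooperad_def quadratic_cooperad_def suspend_AsGDer Let_def cofree_cooperad_def)

lemma suspension_sel:
  "barity (suspension_cooperad :: (_, 'k::field) ns_cooperad) n = n"
  "bdegree (suspension_cooperad :: (_, 'k) ns_cooperad) n = 1 - int n"
  "bcounit (suspension_cooperad :: (_, 'k) ns_cooperad) n = (if n = 1 then 1 else 0)"
  by (simp_all add: suspension_cooperad_def)

lemma barity_agd_hadamard: "barity (agd_hadamard :: (_, 'k::field) ns_cooperad) (n, t) = n"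
  by (simp add: hadamard_def suspension_sel)

definition had_basis :: "kind \<Rightarrow> nat \<Rightarrow> (nat \<times> agd_gen ptree \<Rightarrow>\<^sub>0 'k::field)" where
  "had_basis k n = lin_extend (\<lambda>t. Poly_Mapping.single (n, t) 1) (cobasis k n)"

lemma lookup_had_basis:
  "lookup (had_basis k n) (j, t) = (if j = n \<and> leaves t = n then coef k t else (0::'k::field))"
proof -
  have "lookup (had_basis k n) (j, t) =
    (\<Sum>s\<in>keys (cobasis k n :: _ \<Rightarrow>\<^sub>0 'k). if s = t then if j = n then lookup (cobasis k n) t else (0::'k) else 0)"
    unfolding had_basis_def lookup_lin_extend
    by (intro sum.cong refl) (auto simp: lookup_single when_def)
  also have "\<dots> = (if j = n \<and> leaves t = n then coef k t else 0)"
    by (auto simp: sum.delta in_keys_iff lookup_cobasis)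
  finally show ?thesis .
qed

text \<open>Here the normalisation of \<open>coef\<close> pays off. The exponents
  \<open>(m - 1) * weight s\<close> from the tensor product, \<open>(i - 1) * (m - 1)\<close> from
  \<open>\<S>\<^sup>c\<close> and the one from \<open>coef_graft\<close> add up to an even number,
  since \<open>weight s\<close> is \<open>n - 1\<close> or \<open>n\<close> according to whether the
  unary vertex lies outside or inside \<open>s\<close>.\<close>

lemma lookup_dec_had_basis:
  "lookup (dec agd_hadamard (had_basis k N)) ((n, s), i, (m, t)) =
    (if n = leaves s \<and> m = leaves t \<and> 1 \<le> i \<and> i \<le> n \<and> 1 \<le> m \<and> n + m = N + 1
     then coef KMu s * coef (if k = KD \<and> i \<noteq> 1 then KH else k) t +
       (if k = KMu then 0 else coef k s * coef KMu t)
     else (0::'k::field))"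
proof -
  let ?A = "Pair N ` keys (cobasis k N :: _ \<Rightarrow>\<^sub>0 'k)"
  let ?S = "lookup (bdec suspension_cooperad N) (n, i, m) :: 'k"
  let ?c = "if n = leaves s \<and> m = leaves t then ksign ((1 - int m) * int (weight s)) * ?S else 0"
  have sub: "keys (had_basis k N :: _ \<Rightarrow>\<^sub>0 'k) \<subseteq> ?A"
    by (auto simp: in_keys_iff lookup_had_basis lookup_cobasis split: if_splits)
  have "lookup (dec agd_hadamard (had_basis k N)) ((n, s), i, (m, t)) =
     (\<Sum>b\<in>?A. (lookup (had_basis k N) b :: 'k) * lookup (bdec agd_hadamard b) ((n, s), i, (m, t)))"
    unfolding dec_def by (rule lookup_lin_extend_superset[OF _ sub]) simp
  also have "\<dots> = (\<Sum>u\<in>keys (cobasis k N :: _ \<Rightarrow>\<^sub>0 'k). ?c * (lookup (cobasis k N) u * lookup (bdec agd_cofree u) (s, i, t)))"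
    by (subst sum.reindex)
      (auto simp: inj_on_def lookup_had_basis lookup_cobasis lookup_bdec_hadamard suspension_sel agd_dual_sel
        tdegree_eq_weight intro!: sum.cong)
  also have "\<dots> = ?c * lookup (dec agd_cofree (cobasis k N)) (s, i, t)"
    unfolding dec_def lookup_lin_extend sum_distrib_left ..
  finally have *: "lookup (dec agd_hadamard (had_basis k N)) ((n, s), i, (m, t)) =
    ?c * lookup (dec agd_cofree (cobasis k N)) (s, i, t)" .
  show ?thesis
  proof (cases "n = leaves s \<and> m = leaves t \<and> 1 \<le> i \<and> i \<le> n \<and> 1 \<le> m \<and> n + m = N + 1")
    case False
    then show ?thesis unfolding * lookup_bdec_suspension by auto
  next
    case True
    then have i: "1 \<le> i" "i \<le> leaves s" by auto
    have sq: "graft_sign dg s i t * (graft_sign dg s i t * x) = (x :: 'k)" for x dg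
      by (metis graft_sign_def ksign_square mult.assoc mult.left_neutral)
    have "leaves (graft s i t) = N"
      using leaves_graft(1)[OF i, of t] True by auto
    then have "lookup (dec agd_hadamard (had_basis k N)) ((n, s), i, (m, t)) =
      (ksign ((1 - int m) * int (weight s)) :: 'k) * ksign ((int i - 1) * (int m - 1)) *
       (ksign ((int m + 1) * (int i + int n)) * coef KMu s * coef (if k = KD \<and> i \<noteq> 1 then KH else k) t +
       (if k = KMu then 0 else ksign ((int m + 1) * (int i + int n + 1)) * coef k s * coef KMu t))"
      unfolding * lookup_bdec_suspension
      using True by (simp add: lookup_dec_cofree lookup_cobasis coef_graft[OF i] sq)
    also have "\<dots> = coef KMu s * coef (if k = KD \<and> i \<noteq> 1 then KH else k) t +
       (if k = KMu then 0 else coef k s * coef KMu t)"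
      using True by (cases s rule: coef_cases[where 'k='k]) (auto simp: ksign_def)
    finally show ?thesis using True by simp
  qed
qed

definition hcoef :: "kind \<Rightarrow> nat \<Rightarrow> (nat \<times> agd_gen ptree \<Rightarrow>\<^sub>0 'k::field) \<Rightarrow> 'k" where
  "hcoef k n x = lookup x (n, canon k n) / coef k (canon k n)"

lemma hcoef_linear:
  "hcoef k n 0 = 0"
  "hcoef k n (x + y) = hcoef k n x + hcoef k n y" "hcoef k n (smul c x) = c * hcoef k n x"
  by (simp_all add: hcoef_def lookup_add lookup_smul add_divide_distrib)

lemma hcoef_had_basis: "1 \<le> n \<Longrightarrow> hcoef k n (had_basis k' n) = (if k = k' then 1 else 0)"
  using coef_canon_eq_0_iff[of k' k n, where 'k='a]
  by (auto simp: hcoef_def lookup_had_basis leaves_canon coef_canon_eq_0_iff)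

lemma lookup_tensor:
  "lookup (\<Sum>a\<in>keys x. \<Sum>b\<in>keys y. Poly_Mapping.single (a, b) (lookup x a * lookup y b)) (a, b) =
    lookup x a * (lookup y b :: 'k::field)"
proof -
  have "lookup (\<Sum>a\<in>keys x. \<Sum>b\<in>keys y. Poly_Mapping.single (a, b) (lookup x a * lookup y b)) (a, b) =
    (\<Sum>a'\<in>keys x. if a' = a then \<Sum>b'\<in>keys y. if b' = b then lookup x a * lookup y b else 0 else 0)"
    unfolding lookup_sum
    by (intro sum.cong refl) (auto simp: lookup_single when_def intro!: sum.cong)
  also have "\<dots> = lookup x a * lookup y b"
    by (auto simp: sum.delta in_keys_iff cong: if_cong)
  finally show ?thesis .
qed

lemma had_basis_in_co_part:
  assumes "1 \<le> n"
  shows "had_basis k n \<in> co_part (agd_hadamard :: (_, 'k::field) ns_cooperad) n (int (kdeg k))"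
proof -
  let ?x = "Poly_Mapping.single n 1 :: nat \<Rightarrow>\<^sub>0 'k"
  let ?y = "cobasis k n :: _ \<Rightarrow>\<^sub>0 'k"
  let ?z = "\<Sum>a\<in>keys ?x. \<Sum>b\<in>keys ?y. Poly_Mapping.single (a, b) (lookup ?x a * lookup ?y b)"
  have "had_basis k n = ?z"
    by (rule poly_mapping_eqI, simp only: split_paired_all lookup_tensor)
       (auto simp: lookup_had_basis lookup_cobasis lookup_single when_def)
  moreover have "?x \<in> co_part suspension_cooperad n (1 - int n)"
    using assms by (auto simp: suspension_cooperad_def)
  moreover have "cobasis k n \<in> (agd_dual n (int n - 1 + int (kdeg k)) :: (_ \<Rightarrow>\<^sub>0 'k) set)"
    unfolding agd_dual_eq by (rule cobasis_in_agd_span[OF assms])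
  moreover have "1 - int n + (int n - 1 + int (kdeg k)) = int (kdeg k)" by simp
  ultimately have "had_basis k n \<in> {\<Sum>a\<in>keys x. \<Sum>b\<in>keys y. Poly_Mapping.single (a, b) (lookup x a * lookup y b) | x y p q.
       x \<in> co_part suspension_cooperad n p \<and> y \<in> (agd_dual n q :: (_ \<Rightarrow>\<^sub>0 'k) set) \<and> p + q = int (kdeg k)}"
    by blast
  then show ?thesis
    by (simp add: hadamard_def pm.span_base)
qed

lemma co_part_agd_hadamard:
  assumes n: "1 \<le> n" and z: "z \<in> co_part (agd_hadamard :: (_, 'k::field) ns_cooperad) n d"
  shows co_part_expand: "z = (\<Sum>k\<in>UNIV. smul (hcoef k n z) (had_basis k n))"
    and co_part_degree: "d \<noteq> int (kdeg k) \<Longrightarrow> hcoef k n z = 0"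
proof -
  \<comment> \<open>Both conclusions in a form closed under linear combinations, so that they can be
    verified on pure tensors.\<close>
  let ?ok = "\<lambda>z. (\<forall>j t. lookup z (j, t) = (if j = n \<and> leaves t = n then \<Sum>k\<in>UNIV. hcoef k n z * coef k t else 0)) \<and>
     (\<forall>k. d \<noteq> int (kdeg k) \<longrightarrow> hcoef k n z = 0)"
  have "z \<in> pm.span {\<Sum>a\<in>keys x. \<Sum>b\<in>keys y. Poly_Mapping.single (a, b) (lookup x a * lookup y b) | x y p q.
       x \<in> co_part suspension_cooperad n p \<and> y \<in> (agd_dual n q :: (_ \<Rightarrow>\<^sub>0 'k) set) \<and> p + q = d}"
    using z by (simp add: hadamard_def)
  then have ok: "?ok z"
  proof (induction rule: pm.span_induct)
    case base
    show ?case
      by (auto simp: pm.subspace_def hcoef_linear lookup_add lookup_smul sum.distrib distrib_right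
         sum_distrib_left mult.assoc)
  next
    case (step w)
    then obtain x y p q where w: "w = (\<Sum>a\<in>keys x. \<Sum>b\<in>keys y. Poly_Mapping.single (a, b) (lookup x a * lookup y b))"
      and x: "x \<in> co_part suspension_cooperad n p" and y: "y \<in> (agd_dual n q :: (_ \<Rightarrow>\<^sub>0 'k) set)" and d: "p + q = d"
      by blast
    have x0: "lookup x j = 0" if "j \<noteq> n \<or> p \<noteq> 1 - int n" for j
      using x that by (auto simp: suspension_cooperad_def in_keys_iff)
    have lw: "lookup w (j, t) = lookup x j * lookup y t" for j t
      unfolding w lookup_tensor ..
    have hw: "hcoef k n w = lookup x n * canon_coef k y n" for k
      by (simp add: hcoef_def canon_coef_def lw)
    have "lookup w (j, t) = (if j = n \<and> leaves t = n then \<Sum>k\<in>UNIV. hcoef k n w * coef k t else 0)" for j t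
    proof -
      have "lookup y t = (if leaves t = n then \<Sum>k\<in>UNIV. coef k t * canon_coef k y n else 0)"
        using agd_dual_support(2)[OF y, of t] determined_lookup[OF determined y, of t]
        by (cases "leaves t = n") auto
      then show ?thesis
        using x0[of j] by (auto simp: lw hw sum_distrib_left mult_ac)
    qed
    moreover have "hcoef k n w = 0" if k: "d \<noteq> int (kdeg k)" for k
    proof (rule ccontr)
      assume "hcoef k n w \<noteq> 0"
      then have "lookup x n \<noteq> 0" "lookup y (canon k n) \<noteq> 0" by (auto simp: hw canon_coef_def)
      with x0[of n] agd_dual_support(3)[OF y, of "canon k n"] weight_canon[OF n, of k] d k show False
        by auto
    qed
    ultimately show ?case by blast
  qed
  show "z = (\<Sum>k\<in>UNIV. smul (hcoef k n z) (had_basis k n))"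
    by (rule poly_mapping_eqI, simp only: split_paired_all)
       (use ok in \<open>auto simp: lookup_sum lookup_smul lookup_had_basis\<close>)
  show "hcoef k n z = 0" if "d \<noteq> int (kdeg k)"
    using ok that by blast
qed

lemma subspace_co_arity: "pm.subspace (co_arity C n :: (_ \<Rightarrow>\<^sub>0 'k::field) set)"
  unfolding co_arity_def by (rule pm.subspace_span)

lemma co_part_subset_co_arity: "co_part C n d \<subseteq> (co_arity C n :: (_ \<Rightarrow>\<^sub>0 'k::field) set)"
  unfolding co_arity_def by (intro subset_trans[OF _ pm.span_superset]) blast

lemma had_basis_in_co_arity:
  "1 \<le> n \<Longrightarrow> had_basis k n \<in> co_arity (agd_hadamard :: (_, 'k::field) ns_cooperad) n"
  using had_basis_in_co_part co_part_subset_co_arity by blast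

lemma co_arity_expand:
  assumes n: "1 \<le> n" and z: "z \<in> co_arity (agd_hadamard :: (_, 'k::field) ns_cooperad) n"
  shows "z = (\<Sum>k\<in>UNIV. smul (hcoef k n z) (had_basis k n))"
proof -
  define E where "E z = (\<Sum>k\<in>UNIV. smul (hcoef k n z) (had_basis k n :: _ \<Rightarrow>\<^sub>0 'k))" for z
  have lin: "E 0 = 0" "E (x + y) = E x + E y" "E (smul c x) = smul c (E x)" for x y c
    by (simp_all add: E_def hcoef_linear pm.scale_left_distrib sum.distrib pm.scale_sum_right)
  have "E z = z"
    using z unfolding co_arity_def
  proof (induction rule: pm.span_induct)
    case base
    show ?case by (auto simp: pm.subspace_def lin)
  next
    case (step z)
    then obtain d where "z \<in> co_part agd_hadamard n d" by blast
    from co_part_expand[OF n this] show ?case unfolding E_def by (rule sym)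
  qed
  then show ?thesis by (simp add: E_def)
qed

section \<open>The dual basis and its compositions\<close>

definition op_basis :: "kind \<Rightarrow> nat \<Rightarrow> (nat \<times> agd_gen ptree \<Rightarrow>\<^sub>0 'k::field) \<Rightarrow> 'k" where
  "op_basis k n x = (if x \<in> co_arity agd_hadamard n then hcoef k n x else 0)"

lemma op_basis_had_basis: "1 \<le> n \<Longrightarrow> op_basis k n (had_basis k' n) = (if k = k' then 1 else (0::'k::field))"
  using had_basis_in_co_arity[of n k', where 'k='k] by (simp add: op_basis_def hcoef_had_basis)

abbreviation (input) agd_operad :: "((nat \<times> agd_gen ptree \<Rightarrow>\<^sub>0 'k::field) \<Rightarrow> 'k, 'k) ns_operad" where
  "agd_operad \<equiv> koszul_dual_operad AsGDer"

lemma scl_agd_operad: "scl agd_operad c f = (\<lambda>x. c * f x)"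
  by (simp add: koszul_dual_operad_def linear_dual_def)

lemma op_basis_in_op_part:
  assumes n: "1 \<le> n"
  shows "op_basis k n \<in> op_part (agd_operad :: (_, 'k::field) ns_operad) n (- int (kdeg k))"
proof -
  let ?H = "agd_hadamard :: (_, 'k) ns_cooperad"
  have "op_basis k n (x + y) = op_basis k n x + op_basis k n y" if "x \<in> co_arity ?H n" "y \<in> co_arity ?H n" for x y
    using that pm.subspace_add[OF subspace_co_arity that] by (simp add: op_basis_def hcoef_linear)
  moreover have "op_basis k n (smul c x) = c * op_basis k n x" if "x \<in> co_arity ?H n" for c x
    using that pm.subspace_scale[OF subspace_co_arity that] by (simp add: op_basis_def hcoef_linear)
  moreover have "op_basis k n x = 0" if "x \<in> co_part ?H n e" "e \<noteq> - (- int (kdeg k))" for e x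
    using co_part_degree[OF n that(1), of k] that(2) by (simp add: op_basis_def)
  moreover have "op_basis k n x = 0" if "x \<notin> co_arity ?H n" for x
    using that by (simp add: op_basis_def)
  ultimately show ?thesis
    unfolding koszul_dual_operad_def linear_dual_def ns_operad.simps mem_Collect_eq by blast
qed

interpretation fs: vector_space "\<lambda>(c::'k::field) (f::'b \<Rightarrow> 'k) x. c * f x"
  by standard (auto simp: fun_eq_iff algebra_simps)

lemma op_part_expand:
  assumes n: "1 \<le> n" and f: "f \<in> op_part (agd_operad :: (_, 'k::field) ns_operad) n d"
  shows "f x = (\<Sum>k\<in>UNIV. f (had_basis k n) * op_basis k n x)"
proof (cases "x \<in> co_arity (agd_hadamard :: (_, 'k) ns_cooperad) n")
  case False
  then show ?thesis using f by (simp add: koszul_dual_operad_def linear_dual_def op_basis_def)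
next
  case True
  have add: "f (y + z) = f y + f z"
    if "y \<in> co_arity agd_hadamard n" "z \<in> co_arity agd_hadamard n" for y z
    using that f by (auto simp: koszul_dual_operad_def linear_dual_def)
  have scale: "f (smul c y) = c * f y" if "y \<in> co_arity agd_hadamard n" for y c
    using that f by (auto simp: koszul_dual_operad_def linear_dual_def)
  have mem: "smul c (had_basis k n) \<in> co_arity agd_hadamard n" for c :: 'k and k
    by (intro pm.subspace_scale[OF subspace_co_arity] had_basis_in_co_arity n)
  have "f x = f (\<Sum>k\<in>UNIV. smul (hcoef k n x) (had_basis k n))"
    using co_arity_expand[OF n True] by simp
  also have "\<dots> = (\<Sum>k\<in>UNIV. hcoef k n x * f (had_basis k n))"
    using mem had_basis_in_co_arity[OF n, where 'k='k]
    by (simp add: sum_kind add scale pm.subspace_add[OF subspace_co_arity])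
  finally show ?thesis using True by (simp add: op_basis_def mult.commute)
qed

lemma op_arity_agd_operad:
  assumes n: "1 \<le> n"
  shows "op_arity (agd_operad :: (_, 'k::field) ns_operad) n = range (\<lambda>c x. \<Sum>k\<in>UNIV. c k * op_basis k n x)"
    (is "_ = ?R")
proof -
  have "op_arity agd_operad n = fs.span (\<Union>d. op_part (agd_operad :: (_, 'k) ns_operad) n d)"
    by (simp add: op_arity_def koszul_dual_operad_def linear_dual_def)
  also have "\<dots> = ?R"
  proof
    have "fs.subspace ?R"
      unfolding fs.subspace_def
    proof (intro conjI ballI allI)
      show "0 \<in> ?R" by (rule range_eqI[of _ _ "\<lambda>_. 0"]) (auto simp: fun_eq_iff)
    next
      fix f g assume "f \<in> ?R" "g \<in> ?R"
      then obtain a b where "f = (\<lambda>x. \<Sum>k\<in>UNIV. a k * op_basis k n x)" "g = (\<lambda>x. \<Sum>k\<in>UNIV. b k * op_basis k n x)"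
        by blast
      then show "f + g \<in> ?R"
        by (intro range_eqI[of _ _ "\<lambda>k. a k + b k"]) (auto simp: fun_eq_iff sum.distrib distrib_right)
    next
      fix c f assume "f \<in> ?R"
      then obtain a where "f = (\<lambda>x. \<Sum>k\<in>UNIV. a k * op_basis k n x)"
        by blast
      then show "(\<lambda>x. c * f x) \<in> ?R"
        by (intro range_eqI[of _ _ "\<lambda>k. c * a k"]) (auto simp: fun_eq_iff sum_distrib_left mult.assoc)
    qed
    moreover have "op_part agd_operad n d \<subseteq> ?R" for d
    proof
      fix f :: "_ \<Rightarrow> 'k"
      assume "f \<in> op_part agd_operad n d"
      then have "f = (\<lambda>x. \<Sum>k\<in>UNIV. f (had_basis k n) * op_basis k n x)"
        using op_part_expand[OF n] by (intro ext) blast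
      then show "f \<in> ?R" by (rule range_eqI[where x="\<lambda>k. f (had_basis k n)"])
    qed
    ultimately show "fs.span (\<Union>d. op_part agd_operad n d) \<subseteq> ?R"
      by (intro fs.span_minimal) auto
  next
    have "(\<lambda>x. c k * op_basis k n x) \<in> fs.span (\<Union>d. op_part (agd_operad :: (_, 'k) ns_operad) n d)" for c k
      using op_basis_in_op_part[OF n, of k, where 'k='k] by (intro fs.span_scale fs.span_base) blast
    then have "(\<Sum>k\<in>UNIV. (\<lambda>x. c k * op_basis k n x)) \<in> fs.span (\<Union>d. op_part (agd_operad :: (_, 'k) ns_operad) n d)" for c
      by (intro fs.span_sum)
    moreover have "(\<Sum>k\<in>UNIV. (\<lambda>x. c k * op_basis k n x)) = (\<lambda>x. \<Sum>k\<in>UNIV. c k * op_basis k n x :: 'k)" for c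
      by (simp add: sum_kind fun_eq_iff)
    ultimately show "?R \<subseteq> fs.span (\<Union>d. op_part agd_operad n d)" by auto
  qed
  finally show ?thesis .
qed

lemma dec_at_had_basis:
  assumes "1 \<le> i" "i \<le> n" "1 \<le> m"
  shows "dec_at agd_hadamard n i m (had_basis k (n + m - 1)) =
    (boxtensor i (had_basis KMu n) (had_basis (if k = KD \<and> i \<noteq> 1 then KH else k) m) +
    (if k = KMu then 0 else boxtensor i (had_basis k n) (had_basis KMu m)) :: _ \<Rightarrow>\<^sub>0 'k::field)"
proof (rule poly_mapping_eqI)
  fix z :: "(nat \<times> agd_gen ptree) \<times> nat \<times> (nat \<times> agd_gen ptree)"
  obtain a s j b t where z: "z = ((a, s), j, (b, t))" by (metis prod.exhaust)
  have "n + m = n + m - 1 + 1" using assms by simp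
  then show "lookup (dec_at agd_hadamard n i m (had_basis k (n + m - 1))) z =
    lookup (boxtensor i (had_basis KMu n) (had_basis (if k = KD \<and> i \<noteq> 1 then KH else k) m) +
    (if k = KMu then 0 else boxtensor i (had_basis k n) (had_basis KMu m)) :: _ \<Rightarrow>\<^sub>0 'k) z"
    unfolding z lookup_dec_at barity_agd_hadamard lookup_dec_had_basis
    using assms by (auto simp: lookup_add lookup_boxtensor lookup_had_basis)
qed

lemma dec_at_sum:
  fixes C :: "('b, 'k::field) ns_cooperad"
  assumes "finite A"
  shows "dec_at C n i m (\<Sum>k\<in>A. smul (c k) (x k)) = (\<Sum>k\<in>A. smul (c k) (dec_at C n i m (x k)))"
proof -
  interpret dc: Vector_Spaces.linear smul smul "dec C"
    unfolding dec_def by (rule linear_lin_extend)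
  show ?thesis
  proof (rule poly_mapping_eqI)
    fix z :: "'b \<times> nat \<times> 'b"
    obtain a j b where z: "z = (a, j, b)" by (metis prod.exhaust)
    show "lookup (dec_at C n i m (\<Sum>k\<in>A. smul (c k) (x k))) z =
      lookup (\<Sum>k\<in>A. smul (c k) (dec_at C n i m (x k))) z"
      by (auto simp: z lookup_dec_at dc.sum dc.scale lookup_sum lookup_smul)
  qed
qed

text \<open>The definite description requires a functional and its uniqueness at \<open>w\<close>.
  Reading off one normalised coefficient provides the functional; uniqueness holds because
  \<open>w\<close> lies in the span of the pure tensors on which its values are prescribed.\<close>

lemma tensor_functional_op_basis:
  assumes n: "1 \<le> n" and m: "1 \<le> m"
    and w: "w \<in> pm.span {boxtensor i y z | p q y z.
      y \<in> co_part agd_hadamard n p \<and> z \<in> co_part (agd_hadamard :: (_, 'k::field) ns_cooperad) m q}"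
  shows "tensor_functional agd_hadamard n i m (op_basis k n) (op_basis k' m) w =
    ksign (int (kdeg k) * int (kdeg k')) *
      (lookup w ((n, canon k n), i, (m, canon k' m)) / (coef k (canon k n) * coef k' (canon k' m)))"
    (is "_ = ?T w")
proof -
  let ?P = "\<lambda>T. Vector_Spaces.linear smul (*) T \<and>
       (\<forall>p q. \<forall>y\<in>co_part agd_hadamard n p. \<forall>z\<in>co_part agd_hadamard m q.
          T (boxtensor i y z) = ksign (p * q) * op_basis k n y * (op_basis k' m z :: 'k))"
  define T' where "T' = ?T"
  interpret T': Vector_Spaces.linear smul "(*)" T'
    by unfold_locales (auto simp: T'_def lookup_add lookup_smul add_divide_distrib distrib_left distrib_right)
  have box: "T' (boxtensor i y z) = ksign (p * q) * op_basis k n y * op_basis k' m z"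
    if y: "y \<in> co_part agd_hadamard n p" and z: "z \<in> co_part agd_hadamard m q" for p q y z
  proof -
    have "y \<in> co_arity agd_hadamard n" "z \<in> co_arity agd_hadamard m"
      using y z co_part_subset_co_arity by blast+
    then have eq: "op_basis k n y = hcoef k n y" "op_basis k' m z = hcoef k' m z"
      by (simp_all add: op_basis_def)
    have T: "T' (boxtensor i y z) = ksign (int (kdeg k) * int (kdeg k')) * (hcoef k n y * hcoef k' m z)"
      by (simp add: T'_def lookup_boxtensor hcoef_def)
    \<comment> \<open>The prescribed sign depends on the degrees of \<open>y\<close> and
      \<open>z\<close>; unless these are \<open>kdeg k\<close> and \<open>kdeg k'\<close>, one of
      the coordinates is zero.\<close>
    show ?thesis
      unfolding T eq using co_part_degree[OF n y, of k] co_part_degree[OF m z, of k']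
      by (cases "p = int (kdeg k)"; cases "q = int (kdeg k')") auto
  qed
  have unique: "T w = T' w" if T: "?P T" for T
  proof -
    interpret T: Vector_Spaces.linear smul "(*)" T using T by blast
    show ?thesis
      using w
    proof (induction rule: pm.span_induct)
      case base
      show ?case
        by (auto simp: pm.subspace_def T.add T'.add T.scale T'.scale T.zero T'.zero)
    next
      case (step w)
      then obtain p q y z where w: "w = boxtensor i y z" and yz: "y \<in> co_part agd_hadamard n p" "z \<in> co_part agd_hadamard m q"
        by blast
      then have "T w = ksign (p * q) * op_basis k n y * op_basis k' m z"
        using T by blast
      then show ?case using box[OF yz] w by simp
    qed
  qed
  have P: "?P T'"
    using box T'.linear_axioms by blast
  have "tensor_functional agd_hadamard n i m (op_basis k n) (op_basis k' m) w = T' w"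
    unfolding tensor_functional_def
  proof (rule the_equality)
    show "\<exists>T. Vector_Spaces.linear smul (*) T \<and>
       (\<forall>p q. \<forall>y\<in>co_part agd_hadamard n p. \<forall>z\<in>co_part agd_hadamard m q.
          T (boxtensor i y z) = ksign (p * q) * op_basis k n y * op_basis k' m z) \<and> T w = T' w"
      using P by blast
  qed (use unique in blast)
  then show ?thesis by (simp add: T'_def)
qed

text \<open>Composition is the transpose of \<open>dec_at_had_basis\<close>: the structure constant
  at \<open>k\<close> tells whether the tensor of kinds \<open>k1\<close> and \<open>k2\<close>
  occurs in the decomposition of \<open>had_basis k\<close>.\<close>

lemma pcomp_op_basis:
  assumes "1 \<le> i" "i \<le> n" "1 \<le> m"
  shows "pcomp (agd_operad :: (_, 'k::field) ns_operad) n i m (op_basis k1 n) (op_basis k2 m) =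
    (\<lambda>x. \<Sum>k\<in>UNIV. (if k1 = KMu \<and> k2 = (if k = KD \<and> i \<noteq> 1 then KH else k) \<or> k \<noteq> KMu \<and> k1 = k \<and> k2 = KMu
       then 1 else 0) * op_basis k (n + m - 1) x)"
proof
  fix x :: "nat \<times> agd_gen ptree \<Rightarrow>\<^sub>0 'k"
  let ?N = "n + m - 1"
  let ?H = "agd_hadamard :: (_, 'k) ns_cooperad"
  let ?c = "\<lambda>k. (if k1 = KMu \<and> k2 = (if k = KD \<and> i \<noteq> 1 then KH else k) \<or> k \<noteq> KMu \<and> k1 = k \<and> k2 = KMu
       then 1 else 0) :: 'k"
  have n: "1 \<le> n" "1 \<le> m" "1 \<le> ?N" using assms by auto
  have pc: "pcomp agd_operad n i m (op_basis k1 n) (op_basis k2 m) x =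
    (if x \<in> co_arity ?H ?N then tensor_functional ?H n i m (op_basis k1 n) (op_basis k2 m) (dec_at ?H n i m x) else 0)"
    by (simp add: koszul_dual_operad_def linear_dual_def)
  show "pcomp agd_operad n i m (op_basis k1 n) (op_basis k2 m) x = (\<Sum>k\<in>UNIV. ?c k * op_basis k ?N x)"
  proof (cases "x \<in> co_arity ?H ?N")
    case False
    then show ?thesis unfolding pc by (simp add: op_basis_def)
  next
    case True
    let ?S = "{boxtensor i y z | p q y z. y \<in> co_part ?H n p \<and> z \<in> co_part ?H m q}"
    let ?b = "\<lambda>k. boxtensor i (had_basis KMu n) (had_basis (if k = KD \<and> i \<noteq> 1 then KH else k) m) +
        (if k = KMu then 0 else boxtensor i (had_basis k n) (had_basis KMu m)) :: _ \<Rightarrow>\<^sub>0 'k"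
    have "dec_at ?H n i m x = dec_at ?H n i m (\<Sum>k\<in>UNIV. smul (hcoef k ?N x) (had_basis k ?N))"
      using co_arity_expand[OF n(3) True] by simp
    also have "\<dots> = (\<Sum>k\<in>UNIV. smul (hcoef k ?N x) (?b k))"
      by (simp only: dec_at_sum finite dec_at_had_basis[OF assms])
    finally have dec: "dec_at ?H n i m x = (\<Sum>k\<in>UNIV. smul (hcoef k ?N x) (?b k))" .
    have box: "boxtensor i (had_basis k n) (had_basis k' m) \<in> pm.span ?S" for k k'
      using had_basis_in_co_part[OF n(1), of k, where 'k='k] had_basis_in_co_part[OF n(2), of k', where 'k='k]
      by (intro pm.span_base) blast
    have "?b k \<in> pm.span ?S" for k
      by (rule pm.span_add[OF box], cases "k = KMu") (simp_all only: if_True if_False pm.span_zero box simp_thms)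
    then have "dec_at ?H n i m x \<in> pm.span ?S"
      unfolding dec by (intro pm.span_sum pm.span_scale)
    moreover define c1 c2 :: 'k where "c1 = coef k1 (canon k1 n)" and "c2 = coef k2 (canon k2 m)"
    ultimately have "tensor_functional ?H n i m (op_basis k1 n) (op_basis k2 m) (dec_at ?H n i m x) =
      ksign (int (kdeg k1) * int (kdeg k2)) *
      (lookup (dec_at ?H n i m x) ((n, canon k1 n), i, (m, canon k2 m)) / (c1 * c2))"
      using tensor_functional_op_basis[OF n(1,2)] by blast
    also have "lookup (dec_at ?H n i m x) ((n, canon k1 n), i, (m, canon k2 m)) =
       (\<Sum>k\<in>UNIV. ?c k * hcoef k ?N x * (c1 * c2))"
      unfolding dec lookup_sum
    proof (intro sum.cong refl)
      fix k
      have hb: "lookup (had_basis j n) (n, canon k1 n) = (if j = k1 then c1 else 0)"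
        "lookup (had_basis j m) (m, canon k2 m) = (if j = k2 then c2 else 0)" for j
        using n by (auto simp: lookup_had_basis leaves_canon coef_canon_eq_0_iff c1_def c2_def simp del: canon.simps)
      show "lookup (smul (hcoef k ?N x) (?b k)) ((n, canon k1 n), i, (m, canon k2 m)) =
        ?c k * hcoef k ?N x * (c1 * c2)"
        using hb by (cases k; cases k1; cases k2)
          (simp_all add: lookup_smul lookup_add lookup_boxtensor del: canon.simps)
    qed
    also have "ksign (int (kdeg k1) * int (kdeg k2)) * ((\<Sum>k\<in>UNIV. ?c k * hcoef k ?N x * (c1 * c2)) / (c1 * c2))
      = (\<Sum>k\<in>UNIV. ?c k * hcoef k ?N x)"
    \<comment> \<open>The sign can be -1 only when both arguments have degree -1, and then every
      structure constant is 0.\<close>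
    proof (cases "k1 = KMu \<or> k2 = KMu")
      case True
      then have s: "ksign (int (kdeg k1) * int (kdeg k2)) = (1::'k)" by (auto simp: kdeg_def ksign_def)
      have "c1 * c2 \<noteq> 0" by (simp add: c1_def c2_def coef_canon_eq_0_iff)
      then show ?thesis
        unfolding s sum_distrib_right[symmetric] by simp
    qed (simp add: sum_kind)
    finally show ?thesis using True unfolding pc op_basis_def[of _ ?N x] by simp
  qed
qed

text \<open>The counit is supported at \<open>(1, Leaf)\<close>, and \<open>Leaf\<close> is the
  normal form \<open>canon KMu 1\<close> with coefficient 1.\<close>

lemma ident_agd_operad: "ident (agd_operad :: (_, 'k::field) ns_operad) = op_basis KMu 1"
proof
  fix x :: "nat \<times> agd_gen ptree \<Rightarrow>\<^sub>0 'k"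
  have "counit agd_hadamard x = (\<Sum>b\<in>keys x. if b = (1, Leaf) then lookup x (1, Leaf) else 0)"
    unfolding counit_def
    by (intro sum.cong refl) (auto simp: hadamard_def suspension_sel agd_dual_sel split: if_splits)
  also have "\<dots> = hcoef KMu 1 x"
    by (simp add: hcoef_def in_keys_iff)
  finally show "ident agd_operad x = op_basis KMu 1 x"
    by (simp add: koszul_dual_operad_def linear_dual_def op_basis_def)
qed

theorem proposition0p2:
  fixes P :: "((nat \<times> agd_gen ptree \<Rightarrow>\<^sub>0 'k::field_char_0) \<Rightarrow> 'k, 'k) ns_operad"
  assumes "P = koszul_dual_operad AsGDer"
  shows "\<exists>mu h \<delta>.
    (\<forall>n\<ge>1.
       mu n \<in> op_part P n 0 \<and> h n \<in> op_part P n (-1) \<and> \<delta> n \<in> op_part P n (-1) \<and>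
       bij_betw (\<lambda>(a, b, c). scl P a (mu n) + scl P b (h n) + scl P c (\<delta> n)) UNIV (op_arity P n)) \<and>
    mu 1 = ident P \<and>
    (\<forall>n m i. 1 \<le> n \<and> 1 \<le> m \<and> 1 \<le> i \<and> i \<le> n \<longrightarrow>
       pcomp P n i m (mu n) (mu m) = mu (m + n - 1) \<and>
       pcomp P n i m (h n) (mu m) = h (m + n - 1) \<and>
       pcomp P n i m (\<delta> n) (mu m) = \<delta> (m + n - 1) \<and>
       pcomp P n i m (mu n) (h m) = (if i = 1 then h (m + n - 1) else \<delta> (m + n - 1) + h (m + n - 1)) \<and>
       pcomp P n i m (mu n) (\<delta> m) = (if i = 1 then \<delta> (m + n - 1) else 0) \<and>
       pcomp P n i m (h n) (h m) = 0 \<and>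
       pcomp P n i m (\<delta> n) (h m) = 0 \<and>
       pcomp P n i m (h n) (\<delta> m) = 0 \<and>
       pcomp P n i m (\<delta> n) (\<delta> m) = 0)"
proof -
  have bij: "bij_betw (\<lambda>(a, b, c). scl P a (op_basis KMu n) + scl P b (op_basis KH n) + scl P c (op_basis KD n))
      UNIV (op_arity P n)" (is "bij_betw ?f _ _") if n: "1 \<le> n" for n
  proof (rule bij_betwI')
    \<comment> \<open>Evaluation at the dual elements \<open>had_basis\<close> recovers the three
      scalars, which yields injectivity.\<close>
    have f: "?f (a, b, c) (had_basis KMu n) = a" "?f (a, b, c) (had_basis KH n) = b" "?f (a, b, c) (had_basis KD n) = c" for a b c
      by (simp_all add: assms scl_agd_operad op_basis_had_basis[OF n])
    show "?f u = ?f v \<longleftrightarrow> u = v" for u v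
      by (cases u; cases v) (metis f)
    show "?f u \<in> op_arity P n" for u
      unfolding assms op_arity_agd_operad[OF n]
      by (cases u, rule range_eqI[of _ _ "\<lambda>k. case k of KMu \<Rightarrow> fst u | KH \<Rightarrow> fst (snd u) | KD \<Rightarrow> snd (snd u)"])
         (auto simp: fun_eq_iff scl_agd_operad sum_kind add.assoc)
    show "\<exists>u\<in>UNIV. g = ?f u" if g: "g \<in> op_arity P n" for g
    proof -
      obtain c where "g = (\<lambda>x. \<Sum>k\<in>UNIV. c k * op_basis k n x)"
        using g unfolding assms op_arity_agd_operad[OF n] by blast
      then have "g = ?f (c KMu, c KH, c KD)"
        by (simp add: fun_eq_iff assms scl_agd_operad sum_kind add.assoc)
      then show ?thesis by blast
    qed
  qed
  have comp: "pcomp P n i m (op_basis k1 n) (op_basis k2 m) =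
    (\<lambda>x. \<Sum>k\<in>UNIV. (if k1 = KMu \<and> k2 = (if k = KD \<and> i \<noteq> 1 then KH else k) \<or> k \<noteq> KMu \<and> k1 = k \<and> k2 = KMu
       then 1 else 0) * op_basis k (m + n - 1) x)" if "1 \<le> n" "1 \<le> m" "1 \<le> i" "i \<le> n" for n m i k1 k2
    unfolding assms using pcomp_op_basis[OF that(3,4,2), where 'k='k] by (simp only: add.commute)
  have part: "op_basis KMu n \<in> op_part P n 0" "op_basis KH n \<in> op_part P n (-1)" "op_basis KD n \<in> op_part P n (-1)"
    if "1 \<le> n" for n
    using op_basis_in_op_part[OF that, of KMu, where 'k='k] op_basis_in_op_part[OF that, of KH, where 'k='k]
      op_basis_in_op_part[OF that, of KD, where 'k='k]
    by (simp_all add: assms kdeg_def)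
  show ?thesis
  proof (rule exI[of _ "op_basis KMu"], rule exI[of _ "op_basis KH"], rule exI[of _ "op_basis KD"],
      intro conjI allI impI)
    show "op_basis KMu 1 = ident P" by (simp add: assms ident_agd_operad)
  next
    fix n m i :: nat
    assume "1 \<le> n \<and> 1 \<le> m \<and> 1 \<le> i \<and> i \<le> n"
    then have *: "1 \<le> n" "1 \<le> m" "1 \<le> i" "i \<le> n" by auto
    note comp = comp[OF *]
    show "pcomp P n i m (op_basis KMu n) (op_basis KMu m) = op_basis KMu (m + n - 1)"
      "pcomp P n i m (op_basis KH n) (op_basis KMu m) = op_basis KH (m + n - 1)"
      "pcomp P n i m (op_basis KD n) (op_basis KMu m) = op_basis KD (m + n - 1)"
      "pcomp P n i m (op_basis KMu n) (op_basis KH m) =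
        (if i = 1 then op_basis KH (m + n - 1) else op_basis KD (m + n - 1) + op_basis KH (m + n - 1))"
      "pcomp P n i m (op_basis KMu n) (op_basis KD m) = (if i = 1 then op_basis KD (m + n - 1) else 0)"
      "pcomp P n i m (op_basis KH n) (op_basis KH m) = 0"
      "pcomp P n i m (op_basis KD n) (op_basis KH m) = 0"
      "pcomp P n i m (op_basis KH n) (op_basis KD m) = 0"
      "pcomp P n i m (op_basis KD n) (op_basis KD m) = 0"
      by (simp_all add: comp sum_kind fun_eq_iff add.commute)
  qed (rule part bij; assumption)+
qed

end
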